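(* Let $M=G/K$ be an irreducible Riemannian symmetric space of compact type, with $\mathfrak{g},\sigma,\Delta,\Delta_+,\Pi,\pi,(X_\alpha),(c_{\alpha,\beta})$ and the normalization of $\sigma$ as in the context, and let $s_\alpha$ be defined by $\sigma(X_\alpha)=s_\alpha X_{\sigma(\alpha)}$. Then the following algorithm computes $s_\alpha$ correctly for all $\alpha\in\Delta_+$. (S1) If $M$ is of one of the types $\mathsf{AIII}(n,q)$ with $2q<n-1$, $\mathsf{DIII}(n)$ with $n$ odd, or $\mathsf{EIII}$, put $s_{\alpha_{\pi(1)}}:=c_{\beta,\alpha_1}/c_{\alpha_{\pi(1)},\beta}$ and $s_\alpha:=1$ for all $\alpha\in\Pi\setminus\{\alpha_{\pi(1)}\}$ (with $\alpha_k,\beta$ as in the context). If $M$ is of any other type, put $s_\alpha:=1$ for all $\alpha\in\Pi$. (S2) Iterate steps (S3)--(S6) for $\ell=2,\dots,L$, where $L$ is the maximal level of roots occurring in $\Delta$. (S3) Iterate steps (S4)--(S6) with $\alpha$ running through all roots in $\Delta$ of level $\ell$. (S4) Let $\zeta,\eta$ be positive roots so that $\alpha=\zeta+\eta$. (S5) Put $s_\alpha:=\dfrac{c_{\sigma(\zeta),\sigma(\eta)}}{c_{\zeta,\eta}}\,s_\zeta\,s_\eta$. (S6) (End of loops.)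
   Context: Setting. $\mathfrak{g}$ is the Lie algebra of the transvection group $G$ (its Killing form $\kappa$ is negative definite), $\sigma$ the involutive automorphism of $\mathfrak{g}$ given by the symmetric structure, also extended complex-linearly to $\mathfrak{g}^{\mathbb{C}}$; $\mathfrak{m}=\mathrm{Eig}(\sigma,-1)$; $\mathfrak{a}\subset\mathfrak{m}$ is a maximal flat (abelian) subspace and $\mathfrak{t}\supset\mathfrak{a}$ a Cartan subalgebra of $\mathfrak{g}$; then $\sigma(\mathfrak{t})=\mathfrak{t}$. $\Delta\subset(\mathfrak{t}^{\mathbb{C}})^*$ is the root system; $\alpha^\sharp\in i\mathfrak{t}$ is defined by $\kappa(\alpha^\sharp,\cdot)=\alpha$ on $\mathfrak{t}$; $\sigma(\alpha):=\alpha\circ\sigma^{-1}$. $X\mapsto\overline X$ is the conjugation of $\mathfrak{g}^{\mathbb{C}}$ with respect to $\mathfrak{g}$. The level of a root $\sum_{\alpha\in\Pi}k_\alpha\alpha$ is $\sum_{\alpha\in\Pi}k_\alpha$. Satake's description. $\Delta_+$ with simple roots $\Pi$ is chosen so that $\Pi=\{\alpha_1,\dots,\alpha_r\}\,\dot\cup\,\{\beta_1,\dots,\beta_s\}$ (white and black roots) and there is an involutive permutation $\pi$ of $\{1,\dots,r\}$ with $\sigma(\alpha_k^\sharp)=-\alpha_{\pi(k)}^\sharp-\sum_{j=1}^s n_{kj}\beta_j^\sharp$ for certain integers $n_{kj}\ge0$, and $\sigma(\beta_k^\sharp)=\beta_k^\sharp$. Chevalley basis. $(X_\alpha)_{\alpha\in\Delta}$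 with $X_\alpha\in\mathfrak{g}^{\mathbb{C}}_\alpha$ (root space of $\mathfrak g^{\mathbb C}$) and real constants $c_{\alpha,\beta}$ satisfies $[X_\alpha,X_\beta]=c_{\alpha,\beta}X_{\alpha+\beta}$ if $\alpha+\beta\in\Delta$, $[X_\alpha,X_{-\alpha}]=\alpha^\sharp$, $[X_\alpha,X_\beta]=0$ otherwise, and $c_{-\alpha,-\beta}=-c_{\alpha,\beta}$. Moreover $X_{-\alpha}=-\overline{X_\alpha}$ for all $\alpha$, and, for a fixed family of decompositions $\alpha=\zeta_\alpha+\eta_\alpha$ ($\zeta_\alpha,\eta_\alpha\in\Delta_+$) of the non-simple positive roots, $c_{\zeta_\alpha,\eta_\alpha}>0$. Normalization of $\sigma$. It is assumed that: if $M$ is of type $\mathsf{AIII}(n,q)=\mathrm{SU}(n)/\mathrm{S}(\mathrm{U}(q)\times\mathrm{U}(n-q))$ with $2q<n-1$, $\mathsf{DIII}(n)=\mathrm{SO}(2n)/\mathrm{U}(n)$ with $n$ odd, or $\mathsf{EIII}=E_6/(\mathrm{U}(1)\cdot\mathrm{SO}(10))$, then for the white roots $s_{\alpha_{\pi(1)}}=c_{\beta,\alpha_1}/c_{\alpha_{\pi(1)},\beta}$ and $s_{\alpha_k}=1$ for $k\ne\pi(1)$; for any other type $s_{\alpha_k}=1$ for all white roots $\alpha_k$. Here: for $\mathsf{AIII}(n,q)$ the Dynkin diagram is the chain $\alpha_q,\dots,\alpha_1,\beta_1,\dots,\beta_s,\alpha_{\pi(1)},\dots,\alpha_{\pi(q)}$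 and $\beta=\beta_1+\dots+\beta_s$; for $\mathsf{DIII}(n)$, $\alpha_1,\alpha_{\pi(1)}$ are the two end nodes of the fork of $D_n$ and $\beta$ is the (black) branch node adjacent to both; for $\mathsf{EIII}$ the diagram is the chain $\alpha_1,\beta_1,\beta_2,\beta_3,\alpha_{\pi(1)}$ with $\alpha_2$ attached to $\beta_2$, and $\beta=\beta_1+\beta_2+\beta_3$. *)

theory Defs
  imports
    "HOL-Analysis.Analysis"
    "HOL-Combinatorics.Permutations"
    "HOL-Library.Function_Algebras"
    "Jordan_Normal_Form.Matrix"
begin

section \<open>Real Lie algebras and infinitesimal symmetric spaces\<close>

text \<open>
  A finite-dimensional real Lie algebra is a bracket \<open>br\<close> on a type of class
  \<^class>\<open>euclidean_space\<close>. The inner product of the type plays no role in the theory; it is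
  only used to write down traces of endomorphisms, which do not depend on it.
\<close>

definition lie_bracket :: "('a::euclidean_space \<Rightarrow> 'a \<Rightarrow> 'a) \<Rightarrow> bool" where
  "lie_bracket br \<longleftrightarrow> bilinear br \<and> (\<forall>x. br x x = 0) \<and>
     (\<forall>x y z. br x (br y z) + br y (br z x) + br z (br x y) = 0)"

definition lin_trace :: "('a::euclidean_space \<Rightarrow> 'a) \<Rightarrow> real" where
  "lin_trace f = (\<Sum>b\<in>Basis. inner (f b) b)"

definition killing :: "('a::euclidean_space \<Rightarrow> 'a \<Rightarrow> 'a) \<Rightarrow> 'a \<Rightarrow> 'a \<Rightarrow> real" where
  "killing br x y = lin_trace (\<lambda>z. br x (br y z))"

definition lie_involution :: "('a::euclidean_space \<Rightarrow> 'a \<Rightarrow> 'a) \<Rightarrow> ('a \<Rightarrow> 'a) \<Rightarrow> bool" where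
  "lie_involution br \<sigma> \<longleftrightarrow> linear \<sigma> \<and> (\<forall>x y. \<sigma> (br x y) = br (\<sigma> x) (\<sigma> y)) \<and> (\<forall>x. \<sigma> (\<sigma> x) = x)"

definition fix_part :: "('a::euclidean_space \<Rightarrow> 'a) \<Rightarrow> 'a set" where
  "fix_part \<sigma> = {x. \<sigma> x = x}"

definition m_part :: "('a::euclidean_space \<Rightarrow> 'a) \<Rightarrow> 'a set" where
  "m_part \<sigma> = {x. \<sigma> x = - x}"

text \<open>
  The infinitesimal data of an irreducible Riemannian symmetric space \<open>M = G/K\<close> of compact type:
  the Killing form of \<open>\<gg>\<close> is negative definite; \<open>\<gg>\<close> is the Lie algebra of the transvection group,
  i.e. \<open>\<kk> = [\<mm>, \<mm>]\<close>, so \<open>\<gg> = [\<mm>, \<mm>] \<oplus> \<mm>\<close>; and \<open>M\<close> is irreducible, i.e. the infinitesimal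
  isotropy representation of \<open>\<kk>\<close> on \<open>\<mm> \<noteq> 0\<close> (the tangent space of \<open>M\<close>) is irreducible.
\<close>

definition irreducible_compact_symmetric ::
    "('a::euclidean_space \<Rightarrow> 'a \<Rightarrow> 'a) \<Rightarrow> ('a \<Rightarrow> 'a) \<Rightarrow> bool" where
  "irreducible_compact_symmetric br \<sigma> \<longleftrightarrow>
     lie_bracket br \<and> lie_involution br \<sigma> \<and>
     (\<forall>x. x \<noteq> 0 \<longrightarrow> killing br x x < 0) \<and>
     span {br x y | x y. x \<in> m_part \<sigma> \<and> y \<in> m_part \<sigma>} = fix_part \<sigma> \<and>
     m_part \<sigma> \<noteq> {0} \<and>
     (\<forall>V. subspace V \<and> V \<subseteq> m_part \<sigma> \<and> (\<forall>x\<in>fix_part \<sigma>. \<forall>v\<in>V. br x v \<in> V)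
        \<longrightarrow> V = {0} \<or> V = m_part \<sigma>)"

definition flat_subspace ::
    "('a::euclidean_space \<Rightarrow> 'a \<Rightarrow> 'a) \<Rightarrow> ('a \<Rightarrow> 'a) \<Rightarrow> 'a set \<Rightarrow> bool" where
  "flat_subspace br \<sigma> A \<longleftrightarrow> subspace A \<and> A \<subseteq> m_part \<sigma> \<and> (\<forall>x\<in>A. \<forall>y\<in>A. br x y = 0)"

definition maximal_flat_subspace ::
    "('a::euclidean_space \<Rightarrow> 'a \<Rightarrow> 'a) \<Rightarrow> ('a \<Rightarrow> 'a) \<Rightarrow> 'a set \<Rightarrow> bool" where
  "maximal_flat_subspace br \<sigma> A \<longleftrightarrow> flat_subspace br \<sigma> A \<and>
     (\<forall>B. flat_subspace br \<sigma> B \<and> A \<subseteq> B \<longrightarrow> B = A)"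

primrec lower_central :: "('a::euclidean_space \<Rightarrow> 'a \<Rightarrow> 'a) \<Rightarrow> 'a set \<Rightarrow> nat \<Rightarrow> 'a set" where
  "lower_central br H 0 = H"
| "lower_central br H (Suc n) = span {br x y | x y. x \<in> H \<and> y \<in> lower_central br H n}"

text \<open>A Cartan subalgebra is a nilpotent self-normalizing subalgebra.\<close>

definition cartan_subalgebra :: "('a::euclidean_space \<Rightarrow> 'a \<Rightarrow> 'a) \<Rightarrow> 'a set \<Rightarrow> bool" where
  "cartan_subalgebra br T \<longleftrightarrow> subspace T \<and> (\<forall>x\<in>T. \<forall>y\<in>T. br x y \<in> T) \<and>
     (\<exists>n. lower_central br T n = {0}) \<and> {x. \<forall>y\<in>T. br x y \<in> T} = T"


section \<open>Complexification and roots\<close>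

text \<open>
  The complexification of \<open>\<gg>\<close> is modelled on pairs: \<open>(x, y)\<close> stands for \<open>x + \<i> y\<close>, and \<open>x\<close> in \<open>\<gg>\<close> is
  identified with \<open>(x, 0)\<close>.
\<close>

definition cscale :: "complex \<Rightarrow> 'a::euclidean_space \<times> 'a \<Rightarrow> 'a \<times> 'a" where
  "cscale z X = (Re z *\<^sub>R fst X - Im z *\<^sub>R snd X, Re z *\<^sub>R snd X + Im z *\<^sub>R fst X)"

definition cbr :: "('a::euclidean_space \<Rightarrow> 'a \<Rightarrow> 'a) \<Rightarrow> 'a \<times> 'a \<Rightarrow> 'a \<times> 'a \<Rightarrow> 'a \<times> 'a" where
  "cbr br X Y = (br (fst X) (fst Y) - br (snd X) (snd Y), br (fst X) (snd Y) + br (snd X) (fst Y))"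

definition ckilling ::
    "('a::euclidean_space \<Rightarrow> 'a \<Rightarrow> 'a) \<Rightarrow> 'a \<times> 'a \<Rightarrow> 'a \<times> 'a \<Rightarrow> complex" where
  "ckilling br X Y =
     Complex (killing br (fst X) (fst Y) - killing br (snd X) (snd Y))
             (killing br (fst X) (snd Y) + killing br (snd X) (fst Y))"

definition cext :: "('a::euclidean_space \<Rightarrow> 'a) \<Rightarrow> 'a \<times> 'a \<Rightarrow> 'a \<times> 'a" where
  "cext \<sigma> X = (\<sigma> (fst X), \<sigma> (snd X))"

definition cconj :: "'a::euclidean_space \<times> 'a \<Rightarrow> 'a \<times> 'a" where
  "cconj X = (fst X, - snd X)"

text \<open>
  Elements of the dual of the complexified Cartan subalgebra \<open>T \<times> T\<close> are represented by functions on
  the whole of the complexification that vanish outside \<open>T \<times> T\<close>, so that equality of functionals is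
  equality of functions. Sums and negatives are the pointwise ones.
\<close>

type_synonym 'a functional = "'a \<times> 'a \<Rightarrow> complex"

definition cdual :: "'a::euclidean_space set \<Rightarrow> 'a functional set" where
  "cdual T = {\<alpha>. (\<forall>H\<in>T \<times> T. \<forall>H'\<in>T \<times> T. \<alpha> (H + H') = \<alpha> H + \<alpha> H') \<and>
     (\<forall>z. \<forall>H\<in>T \<times> T. \<alpha> (cscale z H) = z * \<alpha> H) \<and> (\<forall>H. H \<notin> T \<times> T \<longrightarrow> \<alpha> H = 0)}"

definition root_space ::
    "('a::euclidean_space \<Rightarrow> 'a \<Rightarrow> 'a) \<Rightarrow> 'a set \<Rightarrow> 'a functional \<Rightarrow> ('a \<times> 'a) set" where
  "root_space br T \<alpha> = {X. \<forall>H\<in>T \<times> T. cbr br H X = cscale (\<alpha> H) X}"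

definition roots ::
    "('a::euclidean_space \<Rightarrow> 'a \<Rightarrow> 'a) \<Rightarrow> 'a set \<Rightarrow> 'a functional set" where
  "roots br T = {\<alpha> \<in> cdual T. \<alpha> \<noteq> 0 \<and> root_space br T \<alpha> \<noteq> {0}}"

text \<open>The vector \<open>\<alpha>\<^sup>\<sharp>\<close>, an element of \<open>\<i>T = {0} \<times> T\<close>.\<close>

definition sharp ::
    "('a::euclidean_space \<Rightarrow> 'a \<Rightarrow> 'a) \<Rightarrow> 'a set \<Rightarrow> 'a functional \<Rightarrow> 'a \<times> 'a" where
  "sharp br T \<alpha> = (THE H. H \<in> {0} \<times> T \<and> (\<forall>x\<in>T. ckilling br H (x, 0) = \<alpha> (x, 0)))"

definition twist :: "('a::euclidean_space \<Rightarrow> 'a) \<Rightarrow> 'a functional \<Rightarrow> 'a functional" where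
  "twist \<sigma> \<alpha> = \<alpha> \<circ> inv_into UNIV (cext \<sigma>)"


section \<open>Simple roots, levels, Dynkin diagrams\<close>

text \<open>
  The set of simple roots is called \<open>\<Psi>\<close>, since the usual capital Pi is reserved for function spaces.
\<close>

definition combination :: "'a functional set \<Rightarrow> ('a functional \<Rightarrow> int) \<Rightarrow> 'a functional" where
  "combination \<Psi> k = (\<lambda>H. \<Sum>\<gamma>\<in>\<Psi>. of_int (k \<gamma>) * \<gamma> H)"

definition simple_system ::
    "('a::euclidean_space \<Rightarrow> 'a \<Rightarrow> 'a) \<Rightarrow> 'a set \<Rightarrow> 'a functional set \<Rightarrow> bool" where
  "simple_system br T \<Psi> \<longleftrightarrow> finite \<Psi> \<and> \<Psi> \<subseteq> roots br T \<and>
     (\<forall>u :: 'a functional \<Rightarrow> complex. (\<forall>H. (\<Sum>\<gamma>\<in>\<Psi>. u \<gamma> * \<gamma> H) = 0) \<longrightarrow> (\<forall>\<gamma>\<in>\<Psi>. u \<gamma> = 0)) \<and>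
     (\<forall>\<alpha>\<in>roots br T. \<exists>k. \<alpha> = combination \<Psi> k \<and> ((\<forall>\<gamma>\<in>\<Psi>. k \<gamma> \<ge> 0) \<or> (\<forall>\<gamma>\<in>\<Psi>. k \<gamma> \<le> 0)))"

definition positive_roots ::
    "('a::euclidean_space \<Rightarrow> 'a \<Rightarrow> 'a) \<Rightarrow> 'a set \<Rightarrow> 'a functional set \<Rightarrow> 'a functional set" where
  "positive_roots br T \<Psi> =
     {\<alpha> \<in> roots br T. \<exists>k. \<alpha> = combination \<Psi> k \<and> (\<forall>\<gamma>\<in>\<Psi>. k \<gamma> \<ge> 0)}"

definition level :: "'a functional set \<Rightarrow> 'a functional \<Rightarrow> int" where
  "level \<Psi> \<alpha> = (THE l. \<exists>k. \<alpha> = combination \<Psi> k \<and> l = (\<Sum>\<gamma>\<in>\<Psi>. k \<gamma>))"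

definition max_level ::
    "('a::euclidean_space \<Rightarrow> 'a \<Rightarrow> 'a) \<Rightarrow> 'a set \<Rightarrow> 'a functional set \<Rightarrow> int" where
  "max_level br T \<Psi> = Max (level \<Psi> ` roots br T)"

definition cartan_number ::
    "('a::euclidean_space \<Rightarrow> 'a \<Rightarrow> 'a) \<Rightarrow> 'a set \<Rightarrow> 'a functional \<Rightarrow> 'a functional \<Rightarrow> complex" where
  "cartan_number br T \<gamma> \<delta> =
     2 * ckilling br (sharp br T \<gamma>) (sharp br T \<delta>) / ckilling br (sharp br T \<delta>) (sharp br T \<delta>)"

text \<open>
  The Dynkin diagram of \<open>\<Psi>\<close> has only single edges, and these are the pairs in \<open>E\<close>. (The number of
  edges between \<open>\<gamma>\<close> and \<open>\<delta>\<close> is the product of the two Cartan numbers.)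
\<close>

definition dynkin_edges ::
    "('a::euclidean_space \<Rightarrow> 'a \<Rightarrow> 'a) \<Rightarrow> 'a set \<Rightarrow> 'a functional set \<Rightarrow> 'a functional set set \<Rightarrow> bool"
  where
  "dynkin_edges br T \<Psi> E \<longleftrightarrow> (\<forall>\<gamma>\<in>\<Psi>. \<forall>\<delta>\<in>\<Psi>. \<gamma> \<noteq> \<delta> \<longrightarrow>
     cartan_number br T \<gamma> \<delta> * cartan_number br T \<delta> \<gamma> = (if {\<gamma>, \<delta>} \<in> E then 1 else 0))"

definition path_edges :: "'b list \<Rightarrow> 'b set set" where
  "path_edges xs = {{xs ! i, xs ! Suc i} | i. Suc i < length xs}"


section \<open>Satake's description and Chevalley bases\<close>

text \<open>
  White roots \<open>wh 1, \<dots>, wh r\<close>, black roots \<open>bl 1, \<dots>, bl s\<close>.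
\<close>

definition satake_system ::
    "('a::euclidean_space \<Rightarrow> 'a \<Rightarrow> 'a) \<Rightarrow> ('a \<Rightarrow> 'a) \<Rightarrow> 'a set \<Rightarrow> 'a functional set \<Rightarrow> nat \<Rightarrow> nat \<Rightarrow>
     (nat \<Rightarrow> 'a functional) \<Rightarrow> (nat \<Rightarrow> 'a functional) \<Rightarrow> (nat \<Rightarrow> nat) \<Rightarrow> bool" where
  "satake_system br \<sigma> T \<Psi> r s wh bl \<pi> \<longleftrightarrow>
     simple_system br T \<Psi> \<and>
     inj_on wh {1..r} \<and> inj_on bl {1..s} \<and>
     wh ` {1..r} \<inter> bl ` {1..s} = {} \<and> \<Psi> = wh ` {1..r} \<union> bl ` {1..s} \<and>
     \<pi> permutes {1..r} \<and> (\<forall>k. \<pi> (\<pi> k) = k) \<and>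
     (\<exists>n :: nat \<Rightarrow> nat \<Rightarrow> nat. \<forall>k\<in>{1..r}. cext \<sigma> (sharp br T (wh k)) =
        - sharp br T (wh (\<pi> k)) - (\<Sum>j\<in>{1..s}. real (n k j) *\<^sub>R sharp br T (bl j))) \<and>
     (\<forall>k\<in>{1..s}. cext \<sigma> (sharp br T (bl k)) = sharp br T (bl k))"

definition chevalley_basis ::
    "('a::euclidean_space \<Rightarrow> 'a \<Rightarrow> 'a) \<Rightarrow> 'a set \<Rightarrow> 'a functional set \<Rightarrow>
     ('a functional \<Rightarrow> 'a \<times> 'a) \<Rightarrow> ('a functional \<Rightarrow> 'a functional \<Rightarrow> real) \<Rightarrow>
     ('a functional \<Rightarrow> 'a functional) \<Rightarrow> ('a functional \<Rightarrow> 'a functional) \<Rightarrow> bool" where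
  "chevalley_basis br T \<Psi> X c dz de \<longleftrightarrow>
     (\<forall>\<alpha>\<in>roots br T. X \<alpha> \<in> root_space br T \<alpha>) \<and>
     (\<forall>\<alpha>\<in>roots br T. \<forall>\<beta>\<in>roots br T. \<alpha> + \<beta> \<in> roots br T \<longrightarrow>
        cbr br (X \<alpha>) (X \<beta>) = c \<alpha> \<beta> *\<^sub>R X (\<alpha> + \<beta>) \<and> c (- \<alpha>) (- \<beta>) = - c \<alpha> \<beta>) \<and>
     (\<forall>\<alpha>\<in>roots br T. cbr br (X \<alpha>) (X (- \<alpha>)) = sharp br T \<alpha>) \<and>
     (\<forall>\<alpha>\<in>roots br T. \<forall>\<beta>\<in>roots br T. \<alpha> + \<beta> \<notin> roots br T \<and> \<alpha> + \<beta> \<noteq> 0 \<longrightarrow>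
        cbr br (X \<alpha>) (X \<beta>) = 0) \<and>
     (\<forall>\<alpha>\<in>roots br T. X (- \<alpha>) = - cconj (X \<alpha>)) \<and>
     (\<forall>\<alpha>\<in>positive_roots br T \<Psi> - \<Psi>.
        dz \<alpha> \<in> positive_roots br T \<Psi> \<and> de \<alpha> \<in> positive_roots br T \<Psi> \<and>
        \<alpha> = dz \<alpha> + de \<alpha> \<and> c (dz \<alpha>) (de \<alpha>) > 0)"


section \<open>The exceptional types of the normalization\<close>

text \<open>
  Isomorphism of \<open>(\<gg>, \<sigma>)\<close> with a real Lie algebra \<open>S\<close> of matrices (under the commutator)
  with involution \<open>\<tau>\<close>; \<open>\<iota>\<close> embeds the real numbers into the coefficient field.
\<close>

definition matrix_model ::
    "('a::euclidean_space \<Rightarrow> 'a \<Rightarrow> 'a) \<Rightarrow> ('a \<Rightarrow> 'a) \<Rightarrow> (real \<Rightarrow> 'k::field) \<Rightarrow> 'k mat set \<Rightarrow>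
     ('k mat \<Rightarrow> 'k mat) \<Rightarrow> bool" where
  "matrix_model br \<sigma> \<iota> S \<tau> \<longleftrightarrow> (\<exists>\<phi>. bij_betw \<phi> UNIV S \<and>
     (\<forall>x y. \<phi> (x + y) = \<phi> x + \<phi> y) \<and> (\<forall>a x. \<phi> (a *\<^sub>R x) = \<iota> a \<cdot>\<^sub>m \<phi> x) \<and>
     (\<forall>x y. \<phi> (br x y) = \<phi> x * \<phi> y - \<phi> y * \<phi> x) \<and> (\<forall>x. \<phi> (\<sigma> x) = \<tau> (\<phi> x)))"

definition su_mat :: "nat \<Rightarrow> complex mat set" where
  "su_mat n = {A \<in> carrier_mat n n. transpose_mat (map_mat cnj A) = - A \<and> (\<Sum>i<n. A $$ (i, i)) = 0}"

definition so_mat :: "nat \<Rightarrow> real mat set" where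
  "so_mat n = {A \<in> carrier_mat n n. transpose_mat A = - A}"

definition signature_mat :: "nat \<Rightarrow> nat \<Rightarrow> complex mat" where
  "signature_mat q n = mat n n (\<lambda>(i, j). if i = j then (if i < q then - 1 else 1) else 0)"

definition J_mat :: "nat \<Rightarrow> real mat" where
  "J_mat n = four_block_mat (0\<^sub>m n n) (- 1\<^sub>m n) (1\<^sub>m n) (0\<^sub>m n n)"

text \<open>\<open>AIII(n,q) = SU(n)/S(U(q) \<times> U(n-q))\<close>, \<open>DIII(n) = SO(2n)/U(n)\<close> (note \<open>J\<^sup>-\<^sup>1 = -J\<close>).\<close>

definition type_AIII ::
    "('a::euclidean_space \<Rightarrow> 'a \<Rightarrow> 'a) \<Rightarrow> ('a \<Rightarrow> 'a) \<Rightarrow> nat \<Rightarrow> nat \<Rightarrow> bool" where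
  "type_AIII br \<sigma> n q \<longleftrightarrow> 1 \<le> q \<and> q < n \<and>
     matrix_model br \<sigma> complex_of_real (su_mat n) (\<lambda>A. signature_mat q n * A * signature_mat q n)"

definition type_DIII ::
    "('a::euclidean_space \<Rightarrow> 'a \<Rightarrow> 'a) \<Rightarrow> ('a \<Rightarrow> 'a) \<Rightarrow> nat \<Rightarrow> bool" where
  "type_DIII br \<sigma> n \<longleftrightarrow>
     matrix_model br \<sigma> (\<lambda>a. a) (so_mat (2 * n)) (\<lambda>A. J_mat n * A * (- J_mat n))"

text \<open>
  \<open>EIII = E\<^sub>6/(U(1)\<cdot>SO(10))\<close>: the compact Lie algebra \<open>\<gg>\<close> has the Dynkin diagram \<open>E\<^sub>6\<close>, and the
  fixed point algebra of \<open>\<sigma>\<close> is isomorphic to \<open>\<real> \<oplus> \<ss>\<oo>(10)\<close>.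
\<close>

definition type_EIII ::
    "('a::euclidean_space \<Rightarrow> 'a \<Rightarrow> 'a) \<Rightarrow> ('a \<Rightarrow> 'a) \<Rightarrow> 'a set \<Rightarrow> 'a functional set \<Rightarrow> bool" where
  "type_EIII br \<sigma> T \<Psi> \<longleftrightarrow>
     (\<exists>x1 x2 x3 x4 x5 y. distinct [x1, x2, x3, x4, x5, y] \<and> \<Psi> = {x1, x2, x3, x4, x5, y} \<and>
        dynkin_edges br T \<Psi> (path_edges [x1, x2, x3, x4, x5] \<union> {{x3, y}})) \<and>
     (\<exists>\<phi>0 \<phi>. bij_betw (\<lambda>x. (\<phi>0 x, \<phi> x)) (fix_part \<sigma>) ((UNIV :: real set) \<times> so_mat 10) \<and>
        (\<forall>x\<in>fix_part \<sigma>. \<forall>y\<in>fix_part \<sigma>.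
           \<phi>0 (x + y) = \<phi>0 x + \<phi>0 y \<and> \<phi> (x + y) = \<phi> x + \<phi> y \<and>
           \<phi>0 (br x y) = 0 \<and> \<phi> (br x y) = \<phi> x * \<phi> y - \<phi> y * \<phi> x) \<and>
        (\<forall>a. \<forall>x\<in>fix_part \<sigma>. \<phi>0 (a *\<^sub>R x) = a * \<phi>0 x \<and> \<phi> (a *\<^sub>R x) = a \<cdot>\<^sub>m \<phi> x))"

definition special_type ::
    "('a::euclidean_space \<Rightarrow> 'a \<Rightarrow> 'a) \<Rightarrow> ('a \<Rightarrow> 'a) \<Rightarrow> 'a set \<Rightarrow> 'a functional set \<Rightarrow> bool" where
  "special_type br \<sigma> T \<Psi> \<longleftrightarrow>
     (\<exists>n q. 2 * q + 1 < n \<and> type_AIII br \<sigma> n q) \<or> (\<exists>n. odd n \<and> type_DIII br \<sigma> n) \<or>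
     type_EIII br \<sigma> T \<Psi>"

text \<open>
  The numbering of the simple roots and the functional \<open>\<beta>\<close> entering the normalization
  for the three special types. In the case of \<open>DIII\<close>, \<open>D\<^sub>n\<close> is the path through \<open>xs @ [b, wh 1]\<close>
  with \<open>wh (\<pi> 1)\<close> attached to the branch node \<open>b\<close>; this is \<open>A\<^sub>3\<close> for \<open>n = 3\<close>.
\<close>

definition numbering_AIII ::
    "('a::euclidean_space \<Rightarrow> 'a \<Rightarrow> 'a) \<Rightarrow> 'a set \<Rightarrow> 'a functional set \<Rightarrow> nat \<Rightarrow> nat \<Rightarrow>
     (nat \<Rightarrow> 'a functional) \<Rightarrow> (nat \<Rightarrow> 'a functional) \<Rightarrow> (nat \<Rightarrow> nat) \<Rightarrow> nat \<Rightarrow> 'a functional \<Rightarrow> bool"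
  where
  "numbering_AIII br T \<Psi> r s wh bl \<pi> q \<beta> \<longleftrightarrow>
     r = 2 * q \<and>
     (let xs = map wh (rev [1..<Suc q]) @ map bl [1..<Suc s] @ map (\<lambda>k. wh (\<pi> k)) [1..<Suc q]
      in distinct xs \<and> set xs = \<Psi> \<and> dynkin_edges br T \<Psi> (path_edges xs)) \<and>
     \<beta> = (\<Sum>j\<in>{1..s}. bl j)"

definition numbering_DIII ::
    "('a::euclidean_space \<Rightarrow> 'a \<Rightarrow> 'a) \<Rightarrow> 'a set \<Rightarrow> 'a functional set \<Rightarrow> nat \<Rightarrow>
     (nat \<Rightarrow> 'a functional) \<Rightarrow> (nat \<Rightarrow> 'a functional) \<Rightarrow> (nat \<Rightarrow> nat) \<Rightarrow> nat \<Rightarrow> 'a functional \<Rightarrow> bool"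
  where
  "numbering_DIII br T \<Psi> s wh bl \<pi> n \<beta> \<longleftrightarrow>
     (\<exists>xs b. length xs + 3 = n \<and> distinct (xs @ [b, wh 1, wh (\<pi> 1)]) \<and>
        set (xs @ [b, wh 1, wh (\<pi> 1)]) = \<Psi> \<and>
        dynkin_edges br T \<Psi> (path_edges (xs @ [b, wh 1]) \<union> {{b, wh (\<pi> 1)}}) \<and>
        b \<in> bl ` {1..s} \<and> \<beta> = b)"

definition numbering_EIII ::
    "('a::euclidean_space \<Rightarrow> 'a \<Rightarrow> 'a) \<Rightarrow> 'a set \<Rightarrow> 'a functional set \<Rightarrow> nat \<Rightarrow> nat \<Rightarrow>
     (nat \<Rightarrow> 'a functional) \<Rightarrow> (nat \<Rightarrow> 'a functional) \<Rightarrow> (nat \<Rightarrow> nat) \<Rightarrow> 'a functional \<Rightarrow> bool"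
  where
  "numbering_EIII br T \<Psi> r s wh bl \<pi> \<beta> \<longleftrightarrow>
     r = 3 \<and> s = 3 \<and>
     distinct [wh 1, bl 1, bl 2, bl 3, wh (\<pi> 1), wh 2] \<and>
     \<Psi> = {wh 1, bl 1, bl 2, bl 3, wh (\<pi> 1), wh 2} \<and>
     dynkin_edges br T \<Psi> (path_edges [wh 1, bl 1, bl 2, bl 3, wh (\<pi> 1)] \<union> {{wh 2, bl 2}}) \<and>
     \<beta> = bl 1 + bl 2 + bl 3"


section \<open>The algorithm\<close>

text \<open>
  A program state assigns values to finitely many functionals (\<^const>\<open>None\<close>: not yet computed).
  A step fails with \<^const>\<open>None\<close> if an ingredient of the formula is not available: a value
  not yet computed, a structure constant whose indices do not add up to a root, or a zero
  denominator.
\<close>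

type_synonym 'a state = "'a functional \<Rightarrow> complex option"

definition alg_init ::
    "'a functional set \<Rightarrow> bool \<Rightarrow> ('a functional \<Rightarrow> 'a functional \<Rightarrow> real) \<Rightarrow>
     'a functional \<Rightarrow> 'a functional \<Rightarrow> 'a functional \<Rightarrow> 'a state" where
  "alg_init \<Psi> special c \<alpha>1 \<alpha>\<pi>1 \<beta> = (\<lambda>\<gamma>.
     if \<gamma> \<in> \<Psi> then
       Some (if special \<and> \<gamma> = \<alpha>\<pi>1 then complex_of_real (c \<beta> \<alpha>1 / c \<alpha>\<pi>1 \<beta>) else 1)
     else None)"

definition alg_step ::
    "'a::euclidean_space functional set \<Rightarrow> ('a \<Rightarrow> 'a) \<Rightarrow>
     ('a functional \<Rightarrow> 'a functional \<Rightarrow> real) \<Rightarrow> 'a functional \<Rightarrow> 'a functional \<Rightarrow>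
     'a functional \<Rightarrow> 'a state \<Rightarrow> 'a state option" where
  "alg_step \<Delta> \<sigma> c \<zeta> \<eta> \<alpha> st =
     (case (st \<zeta>, st \<eta>) of
        (Some u, Some v) \<Rightarrow>
          if \<zeta> + \<eta> \<in> \<Delta> \<and> twist \<sigma> \<zeta> \<in> \<Delta> \<and> twist \<sigma> \<eta> \<in> \<Delta> \<and>
             twist \<sigma> \<zeta> + twist \<sigma> \<eta> \<in> \<Delta> \<and> c \<zeta> \<eta> \<noteq> 0
          then Some (st(\<alpha> := Some (complex_of_real (c (twist \<sigma> \<zeta>) (twist \<sigma> \<eta>) / c \<zeta> \<eta>) * u * v)))
          else None
      | _ \<Rightarrow> None)"

primrec alg_loop ::
    "'a::euclidean_space functional set \<Rightarrow> ('a \<Rightarrow> 'a) \<Rightarrow>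
     ('a functional \<Rightarrow> 'a functional \<Rightarrow> real) \<Rightarrow>
     ('a functional \<Rightarrow> 'a functional) \<Rightarrow> ('a functional \<Rightarrow> 'a functional) \<Rightarrow>
     'a functional list \<Rightarrow> 'a state \<Rightarrow> 'a state option" where
  "alg_loop \<Delta> \<sigma> c Z E [] st = Some st"
| "alg_loop \<Delta> \<sigma> c Z E (\<alpha> # as) st =
     Option.bind (alg_step \<Delta> \<sigma> c (Z \<alpha>) (E \<alpha>) \<alpha> st) (alg_loop \<Delta> \<sigma> c Z E as)"

text \<open>
  A schedule records the choices made in one run: \<open>ord \<ell>\<close> is the order in which the roots of
  level \<open>\<ell>\<close> are run through, \<open>Z \<alpha>\<close> and \<open>E \<alpha>\<close> are the summands \<open>\<zeta>\<close>, \<open>\<eta>\<close> picked for \<open>\<alpha>\<close>. As every root is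
  visited once, each sequence of choices is of this form.
\<close>

definition alg_schedule ::
    "('a::euclidean_space \<Rightarrow> 'a \<Rightarrow> 'a) \<Rightarrow> 'a set \<Rightarrow> 'a functional set \<Rightarrow>
     (int \<Rightarrow> 'a functional list) \<Rightarrow> ('a functional \<Rightarrow> 'a functional) \<Rightarrow>
     ('a functional \<Rightarrow> 'a functional) \<Rightarrow> bool" where
  "alg_schedule br T \<Psi> ord Z E \<longleftrightarrow>
     (\<forall>l\<in>{2..max_level br T \<Psi>}. distinct (ord l) \<and> set (ord l) = {\<alpha> \<in> roots br T. level \<Psi> \<alpha> = l} \<and>
        (\<forall>\<alpha>\<in>set (ord l). Z \<alpha> \<in> positive_roots br T \<Psi> \<and> E \<alpha> \<in> positive_roots br T \<Psi> \<and>
           \<alpha> = Z \<alpha> + E \<alpha>))"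

definition alg_run ::
    "('a::euclidean_space \<Rightarrow> 'a \<Rightarrow> 'a) \<Rightarrow> ('a \<Rightarrow> 'a) \<Rightarrow> 'a set \<Rightarrow> 'a functional set \<Rightarrow>
     ('a functional \<Rightarrow> 'a functional \<Rightarrow> real) \<Rightarrow> 'a functional \<Rightarrow> 'a functional \<Rightarrow> 'a functional \<Rightarrow>
     (int \<Rightarrow> 'a functional list) \<Rightarrow> ('a functional \<Rightarrow> 'a functional) \<Rightarrow>
     ('a functional \<Rightarrow> 'a functional) \<Rightarrow> 'a state option" where
  "alg_run br \<sigma> T \<Psi> c \<alpha>1 \<alpha>\<pi>1 \<beta> ord Z E =
     alg_loop (roots br T) \<sigma> c Z E (concat (map ord [2..max_level br T \<Psi>]))
       (alg_init \<Psi> (special_type br \<sigma> T \<Psi>) c \<alpha>1 \<alpha>\<pi>1 \<beta>)"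

end

theory Submission
  imports Defs
begin

text \<open>
  Comparing coefficients of \<open>X (\<zeta> + \<eta>)\<close> after applying \<open>\<sigma>\<close> to \<open>[X \<zeta>, X \<eta>]\<close> gives the recursion,
  provided that \<open>c \<zeta> \<eta> \<noteq> 0\<close>. If \<open>c \<zeta> \<eta>\<close> were zero, then by invariance of the Killing form
  \<open>[X (-\<zeta>), X (\<zeta> + \<eta>)] = 0\<close> as well, so \<open>X \<eta>\<close> and \<open>X (\<zeta> + \<eta>)\<close> would be a highest and a lowest weight
  vector for \<open>\<zeta>\<close>; positivity of the hermitian form then gives \<open>\<eta>(\<zeta>\<^sup>\<sharp>) \<ge> 0\<close> and \<open>(\<zeta> + \<eta>)(\<zeta>\<^sup>\<sharp>) \<le> 0\<close>, contradicting
  \<open>\<zeta>(\<zeta>\<^sup>\<sharp>) > 0\<close>.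

  The start values at the black roots are not part of the normalization: a black root \<open>\<gamma>\<close> vanishes
  on \<open>A\<close>, so \<open>X \<gamma> - \<sigma> (X \<gamma>)\<close> centralizes \<open>A\<close>, lies in \<open>A \<times> A\<close> by maximality, and is zero since it also
  belongs to the root space of \<open>\<gamma>\<close>.
\<close>

section \<open>Compact Lie algebras and their complexification\<close>

text \<open>In the orthonormal basis both sides become the same double sum of products of matrix
  entries, with the order of summation exchanged.\<close>

lemma lin_trace_comp_commute:
  fixes f g :: "'a::euclidean_space \<Rightarrow> 'a"
  assumes "linear f" "linear g"
  shows "lin_trace (\<lambda>x. f (g x)) = lin_trace (\<lambda>x. g (f x))"
proof -
  have expand: "inner (p (q b)) b = (\<Sum>c\<in>Basis. inner (q b) c * inner (p c) b)"
    if "linear p" for p q :: "'a \<Rightarrow> 'a" and b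
  proof -
    have "p (q b) = p (\<Sum>c\<in>Basis. inner (q b) c *\<^sub>R c)"
      by (simp add: euclidean_representation)
    also have "\<dots> = (\<Sum>c\<in>Basis. inner (q b) c *\<^sub>R p c)"
      using that by (simp add: linear_sum linear_scale)
    finally show ?thesis
      by (simp add: inner_sum_left)
  qed
  have "lin_trace (\<lambda>x. f (g x)) = (\<Sum>b\<in>Basis. \<Sum>c\<in>Basis. inner (g b) c * inner (f c) b)"
    by (simp add: lin_trace_def expand[OF assms(1)])
  also have "\<dots> = (\<Sum>c\<in>Basis. \<Sum>b\<in>Basis. inner (f c) b * inner (g b) c)"
    by (subst sum.swap) (simp add: mult.commute)
  also have "\<dots> = lin_trace (\<lambda>x. g (f x))"
    by (simp add: lin_trace_def expand[OF assms(2)])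
  finally show ?thesis .
qed

lemma lin_trace_add: "lin_trace (\<lambda>x. f x + g x) = lin_trace f + lin_trace g"
  by (simp add: lin_trace_def inner_add_left sum.distrib)

lemma lin_trace_diff: "lin_trace (\<lambda>x. f x - g x) = lin_trace f - lin_trace g"
  by (simp add: lin_trace_def inner_diff_left sum_subtractf)

lemma lin_trace_scaleR: "lin_trace (\<lambda>x. r *\<^sub>R f x) = r * lin_trace f"
  by (simp add: lin_trace_def sum_distrib_left)

section \<open>Complex scalars and conjugation on pairs\<close>

lemma cscale_simps [simp]:
  "cscale z 0 = 0" "cscale 0 X = 0" "cscale 1 X = X"
  by (simp_all add: cscale_def zero_prod_def)

lemma scaleR_eq_cscale: "r *\<^sub>R X = cscale (complex_of_real r) X"
  by (simp add: cscale_def prod_eq_iff)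

lemma cscale_cscale: "cscale w (cscale z X) = cscale (w * z) X"
  by (simp add: cscale_def prod_eq_iff algebra_simps)

lemma cscale_minus_left: "cscale (- z) X = - cscale z X"
  by (simp add: cscale_def prod_eq_iff)

lemma cscale_minus_right: "cscale z (- X) = - cscale z X"
  by (simp add: cscale_def prod_eq_iff)

lemma cscale_eq_0_iff [simp]: "cscale z X = 0 \<longleftrightarrow> z = 0 \<or> X = 0"
proof
  assume "cscale z X = 0"
  then have "cscale (inverse z * z) X = 0"
    by (simp flip: cscale_cscale)
  then show "z = 0 \<or> X = 0"
    by (cases "z = 0") simp_all
qed auto

text \<open>This is how coefficients of a nonzero vector are compared, in particular in the
  recursion for the signs.\<close>

lemma cscale_left_cancel:
  assumes "cscale z X = cscale w X" "X \<noteq> 0"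
  shows "z = w"
proof -
  have "cscale (z - w) X = cscale z X - cscale w X"
    by (simp add: cscale_def prod_eq_iff algebra_simps)
  with assms show ?thesis by simp
qed

lemma cconj_cconj [simp]: "cconj (cconj X) = X"
  by (simp add: cconj_def)

lemma cconj_eq_0_iff [simp]: "cconj X = 0 \<longleftrightarrow> X = 0"
  by (auto simp: cconj_def prod_eq_iff)

lemma cconj_cscale: "cconj (cscale z X) = cscale (cnj z) (cconj X)"
  by (simp add: cconj_def cscale_def)

lemma complex_pair_decomp: "H = (fst H, 0) + cscale \<i> (snd H, 0)"
  by (simp add: cscale_def prod_eq_iff)

locale compact_lie_algebra =
  fixes br :: "'a::euclidean_space \<Rightarrow> 'a \<Rightarrow> 'a"
  assumes lie: "lie_bracket br"
    and killing_neg: "x \<noteq> 0 \<Longrightarrow> killing br x x < 0"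
begin

section \<open>The real bracket and its Killing form\<close>

lemma br_bilinear: "bilinear br"
  and br_self [simp]: "br x x = 0"
  and br_jacobi: "br x (br y z) + br y (br z x) + br z (br x y) = 0"
  using lie by (auto simp: lie_bracket_def)

lemmas br_simps =
  bilinear_ladd[OF br_bilinear] bilinear_radd[OF br_bilinear]
  bilinear_lsub[OF br_bilinear] bilinear_rsub[OF br_bilinear]
  bilinear_lmul[OF br_bilinear] bilinear_rmul[OF br_bilinear]
  bilinear_lneg[OF br_bilinear] bilinear_rneg[OF br_bilinear]
  bilinear_lzero[OF br_bilinear] bilinear_rzero[OF br_bilinear]

lemma br_linear: "linear (br x)"
  using br_bilinear by (simp add: bilinear_def)

lemma br_skew: "br y x = - br x y"
proof -
  have "br (x + y) (x + y) = br x y + br y x"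
    by (simp only: bilinear_ladd[OF br_bilinear] bilinear_radd[OF br_bilinear]) simp
  then have "br x y + br y x = 0" by (simp only: br_self)
  then show ?thesis by (simp only: add_eq_0_iff)
qed

text \<open>The Jacobi identity in the form that \<open>br\<close> is a representation on itself:
  the operator of a bracket is the commutator of the operators.\<close>

lemma br_br: "br (br x y) z = br x (br y z) - br y (br x z)"
  using br_jacobi[of x y z] br_skew[of z x] br_skew[of z "br x y"]
  by (simp add: br_simps algebra_simps add_eq_0_iff)

lemma killing_commute: "killing br x y = killing br y x"
  unfolding killing_def by (rule lin_trace_comp_commute[OF br_linear br_linear])

lemma killing_add_left: "killing br (x + y) z = killing br x z + killing br y z"
  by (simp add: killing_def br_simps lin_trace_add)

lemma killing_scale_left: "killing br (r *\<^sub>R x) z = r * killing br x z"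
  by (simp add: killing_def br_simps lin_trace_scaleR)

lemma killing_add_right: "killing br z (x + y) = killing br z x + killing br z y"
  by (metis killing_add_left killing_commute)

lemma killing_scale_right: "killing br z (r *\<^sub>R x) = r * killing br z x"
  by (metis killing_scale_left killing_commute)

lemma killing_minus_left: "killing br (- x) z = - killing br x z"
  using killing_scale_left[of "-1"] by simp

lemma killing_minus_right: "killing br z (- x) = - killing br z x"
  using killing_scale_right[of _ "-1"] by simp

lemma killing_diff_left: "killing br (x - y) z = killing br x z - killing br y z"
  using killing_add_left[of x "- y"] by (simp add: killing_minus_left)

lemma killing_diff_right: "killing br z (x - y) = killing br z x - killing br z y"
  by (metis killing_diff_left killing_commute)

lemmas killing_simps =
  killing_add_left killing_add_right killing_scale_left killing_scale_right
  killing_minus_left killing_minus_right killing_diff_left killing_diff_right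

lemma killing_zero [simp]: "killing br 0 z = 0" "killing br z 0 = 0"
  using killing_scale_left[of 0] killing_scale_right[of _ 0] by simp_all

text \<open>After expanding the inner brackets as commutators, the two sides differ only by a cyclic
  rotation of three operators under the trace.\<close>

lemma killing_invariant: "killing br (br x y) z = killing br x (br y z)"
proof -
  have comm: "lin_trace (\<lambda>w. br y (br x (br z w))) = lin_trace (\<lambda>w. br x (br z (br y w)))"
    by (rule lin_trace_comp_commute[OF br_linear])
      (intro linear_compose[OF br_linear br_linear, unfolded o_def])
  show ?thesis
    using comm by (simp add: killing_def br_br lin_trace_diff br_simps)
qed

lemma killing_self_eq_0 [simp]: "killing br x x = 0 \<longleftrightarrow> x = 0"
  using killing_neg[of x] by (cases "x = 0") simp_all

lemma killing_self_nonpos: "killing br x x \<le> 0"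
  using killing_neg[of x] by (cases "x = 0") auto

text \<open>Conjugating by \<sigma> turns the operator of x into that of \<open>\<sigma> x\<close>,
  and the trace does not change under conjugation.\<close>

lemma killing_automorphism:
  assumes \<sigma>: "lie_involution br \<sigma>"
  shows "killing br (\<sigma> x) (\<sigma> y) = killing br x y"
proof -
  have lin: "linear \<sigma>" and hom: "\<And>x y. \<sigma> (br x y) = br (\<sigma> x) (\<sigma> y)" and inv: "\<And>x. \<sigma> (\<sigma> x) = x"
    using \<sigma> by (auto simp: lie_involution_def)
  have "killing br (\<sigma> x) (\<sigma> y) = lin_trace (\<lambda>z. \<sigma> (br x (br y (\<sigma> z))))"
    by (simp add: killing_def hom inv)
  also have "\<dots> = lin_trace (\<lambda>z. br x (br y (\<sigma> (\<sigma> z))))"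
    by (rule lin_trace_comp_commute[OF lin, of "\<lambda>z. br x (br y (\<sigma> z))"])
      (intro linear_compose[OF linear_compose[OF lin br_linear] br_linear, unfolded o_def])
  finally show ?thesis by (simp add: inv killing_def)
qed

section \<open>The complexified bracket and Killing form\<close>

lemma cbr_add_left: "cbr br (X + Y) Z = cbr br X Z + cbr br Y Z"
  and cbr_add_right: "cbr br Z (X + Y) = cbr br Z X + cbr br Z Y"
  and cbr_diff_left: "cbr br (X - Y) Z = cbr br X Z - cbr br Y Z"
  and cbr_diff_right: "cbr br Z (X - Y) = cbr br Z X - cbr br Z Y"
  and cbr_minus_left: "cbr br (- X) Z = - cbr br X Z"
  and cbr_minus_right: "cbr br Z (- X) = - cbr br Z X"
  and cbr_zero_left: "cbr br 0 Z = 0"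
  and cbr_zero_right: "cbr br Z 0 = 0"
  and cbr_cscale_left: "cbr br (cscale w X) Z = cscale w (cbr br X Z)"
  and cbr_cscale_right: "cbr br Z (cscale w X) = cscale w (cbr br Z X)"
  by (simp_all add: cbr_def cscale_def prod_eq_iff br_simps algebra_simps)

lemmas cbr_simps =
  cbr_add_left cbr_add_right cbr_diff_left cbr_diff_right cbr_minus_left cbr_minus_right
  cbr_zero_left cbr_zero_right cbr_cscale_left cbr_cscale_right

lemma cbr_skew: "cbr br Y X = - cbr br X Y"
  using br_skew[of "fst X" "fst Y"] br_skew[of "fst X" "snd Y"]
    br_skew[of "snd X" "fst Y"] br_skew[of "snd X" "snd Y"]
  by (simp add: cbr_def prod_eq_iff)

lemma cbr_cbr: "cbr br (cbr br X Y) Z = cbr br X (cbr br Y Z) - cbr br Y (cbr br X Z)"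
  by (simp add: cbr_def prod_eq_iff br_simps br_br)

lemma cbr_cconj: "cbr br (cconj X) (cconj Y) = cconj (cbr br X Y)"
  by (simp add: cbr_def cconj_def br_simps)

lemma ckilling_add_left: "ckilling br (X + Y) Z = ckilling br X Z + ckilling br Y Z"
  and ckilling_add_right: "ckilling br Z (X + Y) = ckilling br Z X + ckilling br Z Y"
  and ckilling_minus_left: "ckilling br (- X) Z = - ckilling br X Z"
  and ckilling_minus_right: "ckilling br Z (- X) = - ckilling br Z X"
  and ckilling_cscale_left: "ckilling br (cscale w X) Z = w * ckilling br X Z"
  and ckilling_cscale_right: "ckilling br Z (cscale w X) = w * ckilling br Z X"
  and ckilling_zero_left: "ckilling br 0 Z = 0"
  and ckilling_zero_right: "ckilling br Z 0 = 0"
  by (simp_all add: ckilling_def complex_eq_iff cscale_def killing_simps algebra_simps)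

lemmas ckilling_simps =
  ckilling_add_left ckilling_add_right ckilling_minus_left ckilling_minus_right
  ckilling_cscale_left ckilling_cscale_right ckilling_zero_left ckilling_zero_right

lemma ckilling_invariant: "ckilling br (cbr br X Y) Z = ckilling br X (cbr br Y Z)"
  by (simp add: ckilling_def cbr_def complex_eq_iff killing_simps killing_invariant)

text \<open>Pairing with the conjugate gives a hermitian form whose value at X is the sum of the
  Killing values of its real and imaginary parts; all later positivity arguments rest on this form
  being negative definite.\<close>

lemma ckilling_cconj:
  "ckilling br X (cconj X) =
     complex_of_real (killing br (fst X) (fst X) + killing br (snd X) (snd X))"
  by (simp add: ckilling_def cconj_def complex_eq_iff killing_simps killing_commute)

lemma ckilling_cconj_nonpos: "Re (ckilling br X (cconj X)) \<le> 0"
  using killing_self_nonpos[of "fst X"] killing_self_nonpos[of "snd X"]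
  by (simp add: ckilling_cconj)

lemma ckilling_cconj_neg: "X \<noteq> 0 \<Longrightarrow> Re (ckilling br X (cconj X)) < 0"
  using killing_self_nonpos[of "fst X"] killing_self_nonpos[of "snd X"]
    killing_neg[of "fst X"] killing_neg[of "snd X"]
  by (cases "fst X = 0") (auto simp: ckilling_cconj prod_eq_iff)

end

section \<open>Roots and structure constants\<close>

locale compact_cartan = compact_lie_algebra br for br :: "'a::euclidean_space \<Rightarrow> 'a \<Rightarrow> 'a" +
  fixes T :: "'a set"
  assumes cartan: "cartan_subalgebra br T"
begin

section \<open>The Cartan subalgebra and its dual\<close>

lemma T_subspace: "subspace T"
  and T_normalizer: "(\<And>y. y \<in> T \<Longrightarrow> br x y \<in> T) \<Longrightarrow> x \<in> T"
  using cartan by (auto simp: cartan_subalgebra_def)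

lemma T_zero [simp]: "0 \<in> T"
  using T_subspace by (rule subspace_0)

text \<open>\<open>ad x\<close> is skew for the negative definite Killing form, hence nilpotent only if it is zero.\<close>

lemma br_br_self_eq_0:
  assumes "br x (br x y) = 0"
  shows "br x y = 0"
proof -
  have "killing br (br x y) (br x y) = - killing br (br y x) (br x y)"
    by (simp add: br_skew[of x y] killing_simps)
  also have "\<dots> = 0"
    by (simp add: killing_invariant assms)
  finally show ?thesis by simp
qed

text \<open>Nilpotency of \<open>T\<close> makes \<open>br x\<close> nilpotent on \<open>T\<close>,
  and skewness for a definite form then makes it zero there.\<close>

lemma T_abelian:
  assumes "x \<in> T" "y \<in> T"
  shows "br x y = 0"
proof -
  obtain n where n: "lower_central br T n = {0}"
    using cartan by (auto simp: cartan_subalgebra_def)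
  have "(br x ^^ m) y \<in> lower_central br T m" for m
    using assms by (induction m) (auto intro!: span_base)
  with n have "(br x ^^ n) y = 0" by auto
  \<comment> \<open>One extra factor is added so that, when repeated factors are stripped off one at
    a time, exactly one application of \<open>br x\<close> remains.\<close>
  then have "(br x ^^ Suc n) y = 0" by (simp add: br_simps)
  then show ?thesis
    by (induction n) (auto dest: br_br_self_eq_0)
qed

lemma cbr_T_abelian: "H \<in> T \<times> T \<Longrightarrow> H' \<in> T \<times> T \<Longrightarrow> cbr br H H' = 0"
  by (auto simp: cbr_def T_abelian zero_prod_def)

lemma functional_decomp:
  assumes "\<alpha> \<in> cdual T" "H \<in> T \<times> T"
  shows "\<alpha> H = \<alpha> (fst H, 0) + \<i> * \<alpha> (snd H, 0)"
proof -
  have "(fst H, 0) \<in> T \<times> T" "(snd H, 0) \<in> T \<times> T" "cscale \<i> (snd H, 0) \<in> T \<times> T"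
    using assms(2) by (auto simp: cscale_def)
  moreover have "\<alpha> (H + H') = \<alpha> H + \<alpha> H'" "\<alpha> (cscale z H) = z * \<alpha> H"
    if "H \<in> T \<times> T" "H' \<in> T \<times> T" for H H' z
    using assms(1) that unfolding cdual_def by blast+
  ultimately have "\<alpha> ((fst H, 0) + cscale \<i> (snd H, 0)) = \<alpha> (fst H, 0) + \<i> * \<alpha> (snd H, 0)"
    by metis
  then show ?thesis
    by (simp flip: complex_pair_decomp)
qed

text \<open>Complex linearity determines the values on \<open>T \<times> T\<close> from the real
  points, and all other values are zero by the encoding.\<close>

lemma cdual_eqI:
  assumes "\<alpha> \<in> cdual T" "\<beta> \<in> cdual T" "\<And>x. x \<in> T \<Longrightarrow> \<alpha> (x, 0) = \<beta> (x, 0)"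
  shows "\<alpha> = \<beta>"
proof
  fix H
  show "\<alpha> H = \<beta> H"
  proof (cases "H \<in> T \<times> T")
    case True
    then have "fst H \<in> T" "snd H \<in> T" by auto
    with True show ?thesis
      by (simp only: functional_decomp[OF assms(1)] functional_decomp[OF assms(2)] assms(3))
  next
    case False
    then show ?thesis
      using assms(1,2) by (cases H) (auto simp: cdual_def)
  qed
qed

lemma zero_cdual: "0 \<in> cdual T"
  by (simp add: cdual_def)

lemma uminus_cdual: "\<alpha> \<in> cdual T \<Longrightarrow> - \<alpha> \<in> cdual T"
  by (auto simp: cdual_def)

lemma functional_minus:
  assumes "\<alpha> \<in> cdual T" "H \<in> T \<times> T"
  shows "\<alpha> (- H) = - \<alpha> H"
proof -
  have "\<alpha> (cscale (- 1) H) = - 1 * \<alpha> H"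
    using assms unfolding cdual_def by blast
  then show ?thesis by (simp add: cscale_minus_left)
qed

section \<open>Root spaces and conjugation\<close>

lemma root_cdual: "\<alpha> \<in> roots br T \<Longrightarrow> \<alpha> \<in> cdual T"
  by (simp add: roots_def)

lemma root_nonzero_at:
  assumes "\<alpha> \<in> roots br T"
  obtains x where "x \<in> T" "\<alpha> (x, 0) \<noteq> 0"
proof -
  have "\<alpha> \<in> cdual T" "\<alpha> \<noteq> 0"
    using assms by (auto simp: roots_def)
  then show thesis
    using cdual_eqI[OF _ zero_cdual] that by fastforce
qed

lemma root_spaceD: "X \<in> root_space br T \<alpha> \<Longrightarrow> H \<in> T \<times> T \<Longrightarrow> cbr br H X = cscale (\<alpha> H) X"
  unfolding root_space_def by (drule CollectD) (erule bspec)

lemma root_spaceD_right: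
  "X \<in> root_space br T \<alpha> \<Longrightarrow> H \<in> T \<times> T \<Longrightarrow> cbr br X H = - cscale (\<alpha> H) X"
  by (simp add: root_spaceD cbr_skew[of X H])

lemma root_space_nonzero:
  assumes "\<alpha> \<in> roots br T"
  obtains E where "E \<in> root_space br T \<alpha>" "E \<noteq> 0"
proof -
  have "0 \<in> root_space br T \<alpha>"
    by (simp add: root_space_def cbr_simps)
  moreover have "root_space br T \<alpha> \<noteq> {0}"
    using assms by (simp add: roots_def)
  ultimately show thesis
    using that by blast
qed

text \<open>For real x the operator of x is skew-hermitian for the form pairing a vector with the
  conjugate of another, so its eigenvalues are imaginary.\<close>

lemma root_imaginary:
  assumes "\<alpha> \<in> roots br T" "x \<in> T"
  shows "cnj (\<alpha> (x, 0)) = - \<alpha> (x, 0)"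
proof -
  obtain E where E: "E \<in> root_space br T \<alpha>" "E \<noteq> 0"
    using root_space_nonzero[OF assms(1)] .
  let ?H = "(x, 0)" and ?k = "ckilling br E (cconj E)"
  have H: "?H \<in> T \<times> T" "cconj ?H = ?H"
    using assms(2) by (simp_all add: cconj_def)
  have "\<alpha> ?H * ?k = ckilling br (cbr br ?H E) (cconj E)"
    by (simp add: root_spaceD[OF E(1) H(1)] ckilling_simps)
  also have "\<dots> = - ckilling br (cbr br E ?H) (cconj E)"
    by (simp add: cbr_skew[of ?H E] ckilling_simps)
  also have "\<dots> = - ckilling br E (cbr br (cconj ?H) (cconj E))"
    by (simp add: ckilling_invariant H(2))
  also have "\<dots> = - cnj (\<alpha> ?H) * ?k"
    by (simp only: cbr_cconj root_spaceD[OF E(1) H(1)] cconj_cscale ckilling_simps) simp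
  finally have "\<alpha> ?H = - cnj (\<alpha> ?H)"
    using ckilling_cconj_neg[OF E(2)]
    by (metis mult_right_cancel less_irrefl zero_complex.sel(1))
  then show ?thesis
    by (metis minus_minus)
qed

lemma root_cconj:
  assumes "\<alpha> \<in> roots br T" "H \<in> T \<times> T"
  shows "cnj (\<alpha> (cconj H)) = - \<alpha> H"
proof -
  have H: "cconj H \<in> T \<times> T" "fst H \<in> T" "snd H \<in> T"
    using assms(2) T_subspace by (auto simp: cconj_def subspace_neg)
  have "\<alpha> (- (snd H, 0)) = - \<alpha> (snd H, 0)"
    using H by (intro functional_minus root_cdual assms(1)) simp
  then have "\<alpha> (cconj H) = \<alpha> (fst H, 0) - \<i> * \<alpha> (snd H, 0)"
    using functional_decomp[OF root_cdual[OF assms(1)] H(1)] by (simp add: cconj_def)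
  moreover have "\<alpha> H = \<alpha> (fst H, 0) + \<i> * \<alpha> (snd H, 0)"
    using functional_decomp[OF root_cdual[OF assms(1)] assms(2)] .
  ultimately show ?thesis
    using root_imaginary[OF assms(1) H(2)] root_imaginary[OF assms(1) H(3)] by simp
qed

text \<open>Conjugation respects the bracket and is antilinear; since roots are imaginary on
  \<open>T\<close>, the eigenvalue changes its sign.\<close>

lemma cconj_root_space:
  assumes "\<alpha> \<in> roots br T" "E \<in> root_space br T \<alpha>"
  shows "cconj E \<in> root_space br T (- \<alpha>)"
  unfolding root_space_def
proof (intro CollectI ballI)
  fix H assume H: "H \<in> T \<times> T"
  then have H': "cconj H \<in> T \<times> T"
    using T_subspace by (auto simp: cconj_def subspace_neg)
  have "cbr br H (cconj E) = cconj (cbr br (cconj H) E)"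
    by (simp flip: cbr_cconj)
  also have "\<dots> = cscale (- \<alpha> H) (cconj E)"
    by (simp only: root_spaceD[OF assms(2) H'] cconj_cscale root_cconj[OF assms(1) H])
  finally show "cbr br H (cconj E) = cscale ((- \<alpha>) H) (cconj E)"
    by simp
qed

lemma uminus_root:
  assumes "\<alpha> \<in> roots br T"
  shows "- \<alpha> \<in> roots br T"
proof -
  obtain E where E: "E \<in> root_space br T \<alpha>" "E \<noteq> 0"
    using root_space_nonzero[OF assms] .
  then have "cconj E \<in> root_space br T (- \<alpha>)" "cconj E \<noteq> 0"
    using cconj_root_space[OF assms] by auto
  then show ?thesis
    using assms uminus_cdual by (auto simp: roots_def)
qed

section \<open>The vectors dual to the roots\<close>

text \<open>The difference of the imaginary parts lies in \<open>T\<close> and is orthogonal to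
  \<open>T\<close>, hence to itself, so definiteness makes it zero.\<close>

lemma sharp_unique:
  assumes "H \<in> {0} \<times> T" "H' \<in> {0} \<times> T"
    and "\<And>x. x \<in> T \<Longrightarrow> ckilling br H (x, 0) = ckilling br H' (x, 0)"
  shows "H = H'"
proof -
  have "killing br (snd H) x = killing br (snd H') x" if "x \<in> T" for x
    using assms(1,2) assms(3)[OF that] by (auto simp: ckilling_def)
  moreover have "snd H - snd H' \<in> T"
    using assms(1,2) by (auto intro: subspace_diff[OF T_subspace])
  ultimately have "killing br (snd H - snd H') (snd H - snd H') = 0"
    by (simp add: killing_diff_left)
  then show ?thesis
    using assms(1,2) by auto
qed

text \<open>For \<open>E \<noteq> 0\<close> in the root space, \<open>[E, cconj E]\<close> centralizes \<open>T\<close>, hence lies in \<open>\<i>T\<close>, and it is a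
  multiple of \<open>\<alpha>\<^sup>\<sharp>\<close>.\<close>

lemma
  assumes "\<alpha> \<in> roots br T"
  shows sharp_mem: "sharp br T \<alpha> \<in> {0} \<times> T"
    and ckilling_sharp: "H \<in> T \<times> T \<Longrightarrow> ckilling br (sharp br T \<alpha>) H = \<alpha> H"
proof -
  obtain E where E: "E \<in> root_space br T \<alpha>" "E \<noteq> 0"
    using root_space_nonzero[OF assms] .
  define k where "k = killing br (fst E) (fst E) + killing br (snd E) (snd E)"
  have k: "ckilling br E (cconj E) = complex_of_real k" "k \<noteq> 0"
    using ckilling_cconj_neg[OF E(2)] by (auto simp: k_def ckilling_cconj)
  define W where "W = cbr br E (cconj E)"
  note E' = cconj_root_space[OF assms E(1)]
  have right: "cbr br E H = - cscale (\<alpha> H) E" "cbr br (cconj E) H = cscale (\<alpha> H) (cconj E)"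
    if "H \<in> T \<times> T" for H
    using root_spaceD_right[OF E(1) that] root_spaceD_right[OF E' that]
    by (simp_all add: cscale_minus_left)
  \<comment> \<open>Invariance moves the bracket to the right argument, which shows that
    \<open>W\<close> represents k times \<alpha>; this explains the factor \<open>1 / k\<close>
    below.\<close>
  have WH: "ckilling br W H = \<alpha> H * complex_of_real k" if "H \<in> T \<times> T" for H
    by (simp add: W_def ckilling_invariant right[OF that] ckilling_simps k)
  have comm: "cbr br W H = 0" if "H \<in> T \<times> T" for H
    by (simp add: W_def cbr_cbr right[OF that] cbr_simps cbr_skew[of "cconj E" E] cscale_minus_right)
  \<comment> \<open>Conjugation exchanges the two entries of the bracket, so \<open>W\<close> is
    purely imaginary.\<close>
  have "cconj W = cbr br (cconj E) E"
    by (simp add: W_def flip: cbr_cconj)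
  also have "\<dots> = - W"
    by (simp add: W_def cbr_skew[of "cconj E" E])
  finally have "fst W = - fst W"
    by (simp add: cconj_def prod_eq_iff)
  then have "2 *\<^sub>R fst W = 0"
    by (metis scaleR_2 neg_eq_iff_add_eq_0)
  then have W0: "fst W = 0"
    by simp
  have "snd W \<in> T"
  proof (rule T_normalizer)
    fix y assume "y \<in> T"
    then show "br (snd W) y \<in> T"
      using comm[of "(y, 0)"] by (simp add: cbr_def W0 br_simps prod_eq_iff)
  qed
  then have W: "(1 / k) *\<^sub>R W \<in> {0} \<times> T"
    using W0 T_subspace by (auto simp: subspace_scale mem_Times_iff)
  have WH': "ckilling br ((1 / k) *\<^sub>R W) H = \<alpha> H" if "H \<in> T \<times> T" for H
    using k(2) by (simp add: scaleR_eq_cscale ckilling_simps WH[OF that])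
  have "sharp br T \<alpha> = (1 / k) *\<^sub>R W"
    unfolding sharp_def
  proof (rule the_equality)
    show "(1 / k) *\<^sub>R W \<in> {0} \<times> T \<and> (\<forall>x\<in>T. ckilling br ((1 / k) *\<^sub>R W) (x, 0) = \<alpha> (x, 0))"
      using W by (auto simp: WH')
    show "S = (1 / k) *\<^sub>R W"
      if "S \<in> {0} \<times> T \<and> (\<forall>x\<in>T. ckilling br S (x, 0) = \<alpha> (x, 0))" for S
      using that W by (intro sharp_unique) (auto simp: WH')
  qed
  then show "sharp br T \<alpha> \<in> {0} \<times> T"
    and "H \<in> T \<times> T \<Longrightarrow> ckilling br (sharp br T \<alpha>) H = \<alpha> H"
    using W WH' by simp_all
qed

lemma sharp_mem': "\<alpha> \<in> roots br T \<Longrightarrow> sharp br T \<alpha> \<in> T \<times> T"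
  using sharp_mem[of \<alpha>] by auto

lemma sharp_nonzero:
  assumes "\<alpha> \<in> roots br T"
  shows "sharp br T \<alpha> \<noteq> 0"
proof -
  obtain x where "x \<in> T" "\<alpha> (x, 0) \<noteq> 0"
    using root_nonzero_at[OF assms] .
  then show ?thesis
    using ckilling_sharp[OF assms, of "(x, 0)"] by (auto simp: ckilling_zero_left)
qed

text \<open>The dual vector lies in \<open>{0} \<times> T\<close>, the imaginary part, where the
  complexified Killing form is positive definite.\<close>

lemma root_sharp_pos:
  assumes "\<alpha> \<in> roots br T"
  shows "Re (\<alpha> (sharp br T \<alpha>)) > 0"
proof -
  obtain h where h: "sharp br T \<alpha> = (0, h)"
    using sharp_mem[OF assms] by auto
  have "\<alpha> (sharp br T \<alpha>) = ckilling br (sharp br T \<alpha>) (sharp br T \<alpha>)"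
    using ckilling_sharp[OF assms sharp_mem'[OF assms]] by simp
  moreover have "h \<noteq> 0"
    using sharp_nonzero[OF assms] h by (simp add: zero_prod_def)
  ultimately show ?thesis
    using killing_neg[of h] by (simp add: h ckilling_def)
qed

end

locale compact_chevalley = compact_cartan br T
  for br :: "'a::euclidean_space \<Rightarrow> 'a \<Rightarrow> 'a" and T :: "'a set" +
  fixes \<Psi> :: "'a functional set"
    and X :: "'a functional \<Rightarrow> 'a \<times> 'a"
    and c :: "'a functional \<Rightarrow> 'a functional \<Rightarrow> real"
    and dz de :: "'a functional \<Rightarrow> 'a functional"
  assumes chevalley: "chevalley_basis br T \<Psi> X c dz de"
begin

section \<open>Pairings in the Chevalley basis\<close>

lemma X_root_space: "\<alpha> \<in> roots br T \<Longrightarrow> X \<alpha> \<in> root_space br T \<alpha>"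
  and X_bracket: "\<alpha> \<in> roots br T \<Longrightarrow> \<beta> \<in> roots br T \<Longrightarrow> \<alpha> + \<beta> \<in> roots br T \<Longrightarrow>
    cbr br (X \<alpha>) (X \<beta>) = c \<alpha> \<beta> *\<^sub>R X (\<alpha> + \<beta>)"
  and X_bracket_uminus: "\<alpha> \<in> roots br T \<Longrightarrow> cbr br (X \<alpha>) (X (- \<alpha>)) = sharp br T \<alpha>"
  and X_uminus: "\<alpha> \<in> roots br T \<Longrightarrow> X (- \<alpha>) = - cconj (X \<alpha>)"
  using chevalley unfolding chevalley_basis_def by blast+

lemma positive_root_decomp:
  assumes "\<alpha> \<in> positive_roots br T \<Psi> - \<Psi>"
  shows "dz \<alpha> \<in> positive_roots br T \<Psi>" "de \<alpha> \<in> positive_roots br T \<Psi>" "\<alpha> = dz \<alpha> + de \<alpha>"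
  using chevalley assms unfolding chevalley_basis_def by blast+

lemma cconj_X: "\<alpha> \<in> roots br T \<Longrightarrow> cconj (X \<alpha>) = - X (- \<alpha>)"
  by (simp add: X_uminus)

lemma X_nonzero: "\<alpha> \<in> roots br T \<Longrightarrow> X \<alpha> \<noteq> 0"
  using X_bracket_uminus[of \<alpha>] sharp_nonzero[of \<alpha>] by (auto simp: cbr_simps)

lemma sharp_uminus:
  assumes "\<alpha> \<in> roots br T"
  shows "sharp br T (- \<alpha>) = - sharp br T \<alpha>"
proof -
  have "sharp br T (- \<alpha>) = cbr br (X (- \<alpha>)) (X \<alpha>)"
    using X_bracket_uminus[OF uminus_root[OF assms]] by simp
  also have "\<dots> = - sharp br T \<alpha>"
    by (simp only: cbr_skew[of "X (- \<alpha>)" "X \<alpha>"] X_bracket_uminus[OF assms])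
  finally show ?thesis .
qed

text \<open>The Killing pairing of \<open>sharp br T \<alpha>\<close> with \<open>?H\<close> is
  \<open>\<alpha> ?H\<close> by duality, and by invariance also \<open>\<alpha> ?H\<close> times the
  pairing in question.\<close>

lemma ckilling_X_uminus:
  assumes "\<alpha> \<in> roots br T"
  shows "ckilling br (X \<alpha>) (X (- \<alpha>)) = 1"
proof -
  obtain x where x: "x \<in> T" "\<alpha> (x, 0) \<noteq> 0"
    using root_nonzero_at[OF assms] .
  let ?H = "(x, 0)"
  have H: "?H \<in> T \<times> T" using x by simp
  have "\<alpha> ?H = ckilling br (cbr br (X \<alpha>) (X (- \<alpha>))) ?H"
    by (simp only: X_bracket_uminus[OF assms] ckilling_sharp[OF assms H])
  also have "\<dots> = \<alpha> ?H * ckilling br (X \<alpha>) (X (- \<alpha>))"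
    using root_spaceD_right[OF X_root_space[OF uminus_root[OF assms]] H]
    by (simp add: ckilling_invariant ckilling_simps cscale_minus_left)
  finally show ?thesis
    using x(2) by simp
qed

text \<open>Moving \<open>?H\<close> across the form by invariance multiplies the pairing by
  \<alpha> on one side and by \<beta> on the other; some \<open>?H\<close> separates the two
  roots.\<close>

lemma ckilling_X_orthogonal:
  assumes "\<alpha> \<in> roots br T" "\<beta> \<in> roots br T" "\<alpha> \<noteq> \<beta>"
  shows "ckilling br (X \<alpha>) (X (- \<beta>)) = 0"
proof -
  obtain x where x: "x \<in> T" "\<alpha> (x, 0) \<noteq> \<beta> (x, 0)"
    using cdual_eqI[OF root_cdual[OF assms(1)] root_cdual[OF assms(2)]] assms(3) by blast
  let ?H = "(x, 0)" and ?k = "ckilling br (X \<alpha>) (X (- \<beta>))"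
  have H: "?H \<in> T \<times> T" using x by simp
  have "\<alpha> ?H * ?k = - ckilling br (cbr br (X \<alpha>) ?H) (X (- \<beta>))"
    by (simp add: root_spaceD_right[OF X_root_space[OF assms(1)] H] ckilling_simps)
  also have "\<dots> = \<beta> ?H * ?k"
    using root_spaceD[OF X_root_space[OF uminus_root[OF assms(2)]] H]
    by (simp add: ckilling_invariant ckilling_simps cscale_minus_left)
  finally show ?thesis
    using x(2) by simp
qed

text \<open>The vectors \<open>X (- \<beta>)\<close> form a dual family to the vectors
  \<open>X \<alpha>\<close>, which are therefore linearly independent in a finite-dimensional space.
  Finiteness makes the maximal level meaningful and lets each level be listed.\<close>

lemma finite_roots: "finite (roots br T)"
proof -
  have inj: "inj_on X (roots br T)"
    by (rule inj_onI) (metis ckilling_X_orthogonal ckilling_X_uminus zero_neq_one)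
  have "independent (X ` roots br T)"
    unfolding independent_explicit_module
  proof (intro allI impI)
    fix S u v
    assume S: "finite S" "S \<subseteq> X ` roots br T" "(\<Sum>v\<in>S. u v *\<^sub>R v) = 0" "v \<in> S"
    then obtain \<beta> where \<beta>: "\<beta> \<in> roots br T" "v = X \<beta>" by blast
    have sum: "ckilling br (\<Sum>w\<in>F. u w *\<^sub>R w) Y =
        (\<Sum>w\<in>F. complex_of_real (u w) * ckilling br w Y)" if "finite F" for F Y
      using that by (induction F) (simp_all add: ckilling_simps scaleR_eq_cscale)
    \<comment> \<open>Pairing the vanishing combination with \<open>X (- \<beta>)\<close> isolates
      the coefficient of v.\<close>
    have "0 = (\<Sum>w\<in>S. complex_of_real (u w) * ckilling br w (X (- \<beta>)))"
      using sum[OF S(1), of "X (- \<beta>)"] by (simp add: S(3) ckilling_simps)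
    also have "\<dots> = (\<Sum>w\<in>S. if w = v then complex_of_real (u v) else 0)"
    proof (rule sum.cong[OF refl])
      fix w assume "w \<in> S"
      then obtain \<alpha> where "\<alpha> \<in> roots br T" "w = X \<alpha>" using S(2) by blast
      then show "complex_of_real (u w) * ckilling br w (X (- \<beta>)) =
          (if w = v then complex_of_real (u v) else 0)"
        using \<beta> inj_onD[OF inj] ckilling_X_orthogonal[of \<alpha> \<beta>]
        by (cases "\<alpha> = \<beta>") (auto simp: ckilling_X_uminus)
    qed
    also have "\<dots> = complex_of_real (u v)"
      using S(1,4) by simp
    finally show "u v = 0" by simp
  qed
  then have "finite (X ` roots br T)"
    by (rule independent_imp_finite)
  then show ?thesis
    using inj by (rule finite_imageD)
qed

section \<open>Nonvanishing of the structure constants\<close>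

text \<open>If \<open>X \<beta>\<close> is a highest weight vector for the \<open>\<ss>\<ll>\<^sub>2\<close>-triple of \<open>\<alpha>\<close>, then \<open>\<beta>(\<alpha>\<^sup>\<sharp>)\<close> is the squared norm
  of \<open>[X (-\<alpha>), X \<beta>]\<close> for the hermitian form given by \<open>- ckilling br Y (cconj Y)\<close>.\<close>

lemma highest_weight_nonneg:
  assumes \<alpha>: "\<alpha> \<in> roots br T" and \<beta>: "\<beta> \<in> roots br T" and zero: "cbr br (X \<alpha>) (X \<beta>) = 0"
  shows "Re (\<beta> (sharp br T \<alpha>)) \<ge> 0"
proof -
  have \<alpha>': "- \<alpha> \<in> roots br T" and \<beta>': "- \<beta> \<in> roots br T"
    using \<alpha> \<beta> by (auto intro: uminus_root)
  have zero': "cbr br (X (- \<alpha>)) (X (- \<beta>)) = 0"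
    by (simp add: X_uminus \<alpha> \<beta> cbr_simps cbr_cconj zero)
  define W where "W = cbr br (X (- \<alpha>)) (X \<beta>)"
  have conj: "cconj W = cbr br (X \<alpha>) (X (- \<beta>))"
    using cconj_X[OF \<alpha>'] cconj_X[OF \<beta>] by (simp add: W_def cbr_simps flip: cbr_cconj)
  \<comment> \<open>The Jacobi identity is applied to \<open>sharp br T \<alpha>\<close> written as
    a bracket; one of its two terms vanishes by \<open>zero'\<close>.\<close>
  have "cbr br (sharp br T \<alpha>) (X (- \<beta>)) = - cbr br (X (- \<alpha>)) (cconj W)"
    unfolding conj X_bracket_uminus[OF \<alpha>, symmetric] cbr_cbr zero' by (simp add: cbr_simps)
  moreover have "cbr br (sharp br T \<alpha>) (X (- \<beta>)) = - cscale (\<beta> (sharp br T \<alpha>)) (X (- \<beta>))"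
    using root_spaceD[OF X_root_space[OF \<beta>'] sharp_mem'[OF \<alpha>]] by (simp add: cscale_minus_left)
  ultimately have lower: "cbr br (X (- \<alpha>)) (cconj W) = cscale (\<beta> (sharp br T \<alpha>)) (X (- \<beta>))"
    by simp
  have "ckilling br W (cconj W) = - ckilling br (cbr br (X \<beta>) (X (- \<alpha>))) (cconj W)"
    by (simp add: W_def cbr_skew[of "X (- \<alpha>)" "X \<beta>"] ckilling_simps)
  also have "\<dots> = - \<beta> (sharp br T \<alpha>)"
    by (simp add: ckilling_invariant lower ckilling_simps ckilling_X_uminus[OF \<beta>])
  finally show ?thesis
    using ckilling_cconj_nonpos[of W] by simp
qed

lemma structure_constant_nonzero:
  assumes \<alpha>: "\<alpha> \<in> roots br T" and \<beta>: "\<beta> \<in> roots br T" and \<gamma>: "\<alpha> + \<beta> \<in> roots br T"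
  shows "c \<alpha> \<beta> \<noteq> 0"
proof
  assume "c \<alpha> \<beta> = 0"
  then have zero: "cbr br (X \<alpha>) (X \<beta>) = 0"
    using X_bracket[OF \<alpha> \<beta> \<gamma>] by simp
  have \<alpha>': "- \<alpha> \<in> roots br T" using \<alpha> by (rule uminus_root)
  have zero': "cbr br (X (- \<alpha>)) (X (- \<beta>)) = 0"
    by (simp add: X_uminus \<alpha> \<beta> cbr_simps cbr_cconj zero)
  have bracket: "cbr br (X (- \<alpha>)) (X (\<alpha> + \<beta>)) = c (- \<alpha>) (\<alpha> + \<beta>) *\<^sub>R X \<beta>"
    using X_bracket[OF \<alpha>' \<gamma>] \<beta> by simp
  \<comment> \<open>The constant is read off by pairing with \<open>X (- \<beta>)\<close>, and
    invariance turns it into a pairing with the bracket known to vanish.\<close>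
  have "complex_of_real (c (- \<alpha>) (\<alpha> + \<beta>)) =
      ckilling br (cbr br (X (- \<alpha>)) (X (\<alpha> + \<beta>))) (X (- \<beta>))"
    by (simp add: bracket scaleR_eq_cscale ckilling_simps ckilling_X_uminus[OF \<beta>])
  also have "\<dots> = - ckilling br (X (\<alpha> + \<beta>)) (cbr br (X (- \<alpha>)) (X (- \<beta>)))"
    by (simp add: cbr_skew[of "X (- \<alpha>)" "X (\<alpha> + \<beta>)"] ckilling_simps ckilling_invariant)
  also have "\<dots> = 0"
    by (simp add: zero' ckilling_simps)
  finally have "cbr br (X (- \<alpha>)) (X (\<alpha> + \<beta>)) = 0"
    by (simp add: bracket)
  then have "Re ((\<alpha> + \<beta>) (sharp br T (- \<alpha>))) \<ge> 0"
    by (rule highest_weight_nonneg[OF \<alpha>' \<gamma>])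
  moreover have "Re (\<beta> (sharp br T \<alpha>)) \<ge> 0"
    by (rule highest_weight_nonneg[OF \<alpha> \<beta> zero])
  ultimately show False
    using root_sharp_pos[OF \<alpha>] sharp_mem'[OF \<alpha>] \<alpha> \<beta>
    by (simp add: sharp_uminus functional_minus root_cdual)
qed

end

section \<open>The involution\<close>

lemma inv_cext:
  assumes "lie_involution br \<sigma>"
  shows "inv_into UNIV (cext \<sigma>) = cext \<sigma>"
  using assms by (intro inv_unique_comp) (auto simp: lie_involution_def cext_def fun_eq_iff)

locale compact_symmetric_chevalley = compact_chevalley br T \<Psi> X c dz de
  for br :: "'a::euclidean_space \<Rightarrow> 'a \<Rightarrow> 'a" and T \<Psi> X c dz de +
  fixes \<sigma> :: "'a \<Rightarrow> 'a" and A :: "'a set"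
  assumes involution: "lie_involution br \<sigma>"
    and flat: "maximal_flat_subspace br \<sigma> A"
    and A_subset_T: "A \<subseteq> T"
begin

section \<open>Complex extension of the involution\<close>

lemma \<sigma>_linear: "linear \<sigma>"
  and \<sigma>_br: "\<sigma> (br x y) = br (\<sigma> x) (\<sigma> y)"
  and \<sigma>_\<sigma> [simp]: "\<sigma> (\<sigma> x) = x"
  using involution by (auto simp: lie_involution_def)

lemmas \<sigma>_simps =
  linear_add[OF \<sigma>_linear] linear_diff[OF \<sigma>_linear] linear_scale[OF \<sigma>_linear]
  linear_neg[OF \<sigma>_linear] linear_0[OF \<sigma>_linear]

lemma cext_cext [simp]: "cext \<sigma> (cext \<sigma> H) = H"
  by (simp add: cext_def)

lemma cext_cbr: "cext \<sigma> (cbr br Y Z) = cbr br (cext \<sigma> Y) (cext \<sigma> Z)"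
  by (simp add: cext_def cbr_def \<sigma>_br \<sigma>_simps)

lemma cext_cscale: "cext \<sigma> (cscale z Y) = cscale z (cext \<sigma> Y)"
  by (simp add: cext_def cscale_def \<sigma>_simps)

lemma cext_add: "cext \<sigma> (Y + Z) = cext \<sigma> Y + cext \<sigma> Z"
  by (simp add: cext_def \<sigma>_simps)

lemma ckilling_cext: "ckilling br (cext \<sigma> Y) (cext \<sigma> Z) = ckilling br Y Z"
  by (simp add: ckilling_def cext_def killing_automorphism[OF involution])

section \<open>Centralizers of the maximal flat subspace\<close>

text \<open>Adjoining v to \<open>A\<close> and taking the span gives a flat subspace again, so
  maximality absorbs v.\<close>

lemma flat_mem:
  assumes v: "v \<in> m_part \<sigma>" and comm: "\<And>a. a \<in> A \<Longrightarrow> br a v = 0"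
  shows "v \<in> A"
proof -
  have A: "subspace A" "A \<subseteq> m_part \<sigma>" "\<And>x y. x \<in> A \<Longrightarrow> y \<in> A \<Longrightarrow> br x y = 0"
    and max: "\<And>B. flat_subspace br \<sigma> B \<Longrightarrow> A \<subseteq> B \<Longrightarrow> B = A"
    using flat by (auto simp: maximal_flat_subspace_def flat_subspace_def)
  let ?S = "insert v A"
  have S: "br x y = 0" if "x \<in> ?S" "y \<in> ?S" for x y
    using that comm A(3) by (auto simp: br_skew[of _ v])
  have "subspace (m_part \<sigma>)"
    by (auto simp: subspace_def m_part_def \<sigma>_simps)
  then have "span ?S \<subseteq> m_part \<sigma>"
    using A(2) v by (intro span_minimal) auto
  \<comment> \<open>Commutation of the generators extends to the span by bilinearity, through an
    induction in each argument.\<close>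
  moreover have "br x y = 0" if "x \<in> span ?S" "y \<in> span ?S" for x y
    using that
  proof (induction x rule: span_induct_alt)
    case base
    show ?case by (simp add: br_simps)
  next
    case (step r x z)
    have "br x y = 0"
      using step.prems
    proof (induction y rule: span_induct_alt)
      case base
      show ?case by (simp add: br_simps)
    next
      case (step q u w)
      then show ?case using S[of x u] \<open>x \<in> ?S\<close> by (simp add: br_simps)
    qed
    with step show ?case by (simp add: br_simps)
  qed
  ultimately have "flat_subspace br \<sigma> (span ?S)"
    by (auto simp: flat_subspace_def)
  then have "span ?S = A"
    by (rule max) (auto intro: span_base)
  then show ?thesis
    by (metis insertI1 span_base)
qed

lemma \<sigma>_A: "a \<in> A \<Longrightarrow> \<sigma> a = - a"
  using flat by (auto simp: maximal_flat_subspace_def flat_subspace_def m_part_def)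

text \<open>Because \<sigma> is -1 on \<open>A\<close>, it preserves the centralizer of
  \<open>A\<close>; the difference is anti-invariant and still centralizes \<open>A\<close>.\<close>

lemma centralizer_diff_mem:
  assumes "\<And>a. a \<in> A \<Longrightarrow> br a x = 0"
  shows "x - \<sigma> x \<in> A"
proof (rule flat_mem)
  show "x - \<sigma> x \<in> m_part \<sigma>"
    by (simp add: m_part_def \<sigma>_simps)
  fix a assume "a \<in> A"
  then have "br a (\<sigma> x) = - \<sigma> (br a x)"
    by (simp add: \<sigma>_br \<sigma>_A br_simps)
  then show "br a (x - \<sigma> x) = 0"
    using assms[OF \<open>a \<in> A\<close>] by (simp add: br_simps \<sigma>_simps)
qed

text \<open>As \<open>T\<close> is abelian and contains \<open>A\<close>, it centralizes
  \<open>A\<close>, so x and its image differ by an element of \<open>A\<close>.\<close>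

lemma \<sigma>_T:
  assumes "x \<in> T"
  shows "\<sigma> x \<in> T"
proof -
  have "x - \<sigma> x \<in> T"
    using centralizer_diff_mem[of x] A_subset_T T_abelian assms by blast
  then have "x - (x - \<sigma> x) \<in> T"
    by (rule subspace_diff[OF T_subspace assms])
  then show ?thesis by simp
qed

lemma cext_T: "H \<in> T \<times> T \<Longrightarrow> cext \<sigma> H \<in> T \<times> T"
  by (auto simp: cext_def \<sigma>_T)

lemma cext_T_iff: "cext \<sigma> H \<in> T \<times> T \<longleftrightarrow> H \<in> T \<times> T"
  using cext_T[of H] cext_T[of "cext \<sigma> H"] by auto

section \<open>Action of the involution on roots\<close>

lemma twist_apply: "twist \<sigma> \<alpha> H = \<alpha> (cext \<sigma> H)"
  by (simp add: twist_def inv_cext[OF involution])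

lemma twist_add: "twist \<sigma> (\<alpha> + \<beta>) = twist \<sigma> \<alpha> + twist \<sigma> \<beta>"
  by (simp add: fun_eq_iff twist_apply)

lemma twist_cdual:
  assumes "\<alpha> \<in> cdual T"
  shows "twist \<sigma> \<alpha> \<in> cdual T"
proof -
  have 1: "\<alpha> (H + H') = \<alpha> H + \<alpha> H'" if "H \<in> T \<times> T" "H' \<in> T \<times> T" for H H'
    using assms that unfolding cdual_def by blast
  have 2: "\<alpha> (cscale z H) = z * \<alpha> H" if "H \<in> T \<times> T" for H z
    using assms that unfolding cdual_def by blast
  have 3: "\<alpha> H = 0" if "H \<notin> T \<times> T" for H
    using assms that unfolding cdual_def by blast
  show ?thesis
    unfolding cdual_def
    by (intro CollectI conjI ballI allI impI)
      (simp_all only: twist_apply cext_add cext_cscale 1 2 3 cext_T cext_T_iff not_False_eq_True)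
qed

text \<open>An automorphism preserving \<open>T \<times> T\<close> permutes the weight
  spaces.\<close>

lemma cext_root_space:
  assumes "Y \<in> root_space br T \<alpha>"
  shows "cext \<sigma> Y \<in> root_space br T (twist \<sigma> \<alpha>)"
  unfolding root_space_def
proof (intro CollectI ballI)
  fix H assume "H \<in> T \<times> T"
  then have "cbr br (cext \<sigma> H) Y = cscale (\<alpha> (cext \<sigma> H)) Y"
    by (intro root_spaceD assms cext_T)
  then have "cext \<sigma> (cbr br (cext \<sigma> H) Y) = cext \<sigma> (cscale (\<alpha> (cext \<sigma> H)) Y)"
    by simp
  then show "cbr br H (cext \<sigma> Y) = cscale (twist \<sigma> \<alpha> H) (cext \<sigma> Y)"
    by (simp add: cext_cbr cext_cscale twist_apply)
qed

lemma twist_root: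
  assumes "\<alpha> \<in> roots br T"
  shows "twist \<sigma> \<alpha> \<in> roots br T"
proof -
  obtain E where E: "E \<in> root_space br T \<alpha>" "E \<noteq> 0"
    using root_space_nonzero[OF assms] .
  have "cext \<sigma> E \<noteq> 0"
    using E(2) cext_cext[of E] by (metis cext_cscale cscale_simps(2))
  moreover have "twist \<sigma> \<alpha> \<noteq> 0"
  proof
    assume "twist \<sigma> \<alpha> = 0"
    then have "\<alpha> (cext \<sigma> (cext \<sigma> H)) = 0" for H
      by (metis twist_apply zero_fun_apply)
    then have "\<alpha> = 0" by (simp add: fun_eq_iff)
    then show False using assms by (simp add: roots_def)
  qed
  ultimately show ?thesis
    using cext_root_space[OF E(1)] twist_cdual[OF root_cdual[OF assms]] by (auto simp: roots_def)
qed

section \<open>Signs of fixed roots and of sums of roots\<close>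

lemma cext_X_fixed:
  assumes \<beta>: "\<beta> \<in> roots br T" and fixed: "cext \<sigma> (sharp br T \<beta>) = sharp br T \<beta>"
  shows "twist \<sigma> \<beta> = \<beta>" and "cext \<sigma> (X \<beta>) = X \<beta>"
proof -
  \<comment> \<open>Here \<beta> is the pairing with a vector fixed by \<sigma>, and the Killing
    form is \<sigma>-invariant.\<close>
  have inv: "\<beta> (cext \<sigma> H) = \<beta> H" if H: "H \<in> T \<times> T" for H
  proof -
    have "\<beta> (cext \<sigma> H) = ckilling br (cext \<sigma> (sharp br T \<beta>)) (cext \<sigma> H)"
      by (simp only: fixed ckilling_sharp[OF \<beta> cext_T[OF H]])
    also have "\<dots> = \<beta> H"
      by (simp only: ckilling_cext ckilling_sharp[OF \<beta> H])
    finally show ?thesis .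
  qed
  show twist: "twist \<sigma> \<beta> = \<beta>"
    by (rule cdual_eqI) (auto simp: twist_apply inv intro: \<beta> root_cdual twist_root)
  \<comment> \<open>Invariance of \<beta> meets the sign change of \<sigma> on \<open>A\<close>, so
    the value equals its own negative.\<close>
  have vanish: "\<beta> (a, 0) = 0" if "a \<in> A" for a
  proof -
    have a: "(a, 0) \<in> T \<times> T" using that A_subset_T by auto
    have "\<beta> (- (a, 0)) = \<beta> (a, 0)"
      using inv[OF a] that by (simp add: cext_def \<sigma>_A \<sigma>_simps)
    then show ?thesis
      using functional_minus[OF root_cdual[OF \<beta>] a] by simp
  qed
  let ?W = "X \<beta> - cext \<sigma> (X \<beta>)"
  have "br a (fst (X \<beta>)) = 0 \<and> br a (snd (X \<beta>)) = 0" if "a \<in> A" for a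
  proof -
    have "(a, 0) \<in> T \<times> T" using that A_subset_T by auto
    then have "cbr br (a, 0) (X \<beta>) = 0"
      using root_spaceD[OF X_root_space[OF \<beta>]] vanish[OF that] by simp
    then show ?thesis
      by (simp add: cbr_def br_simps prod_eq_iff)
  qed
  then have "fst ?W \<in> A" "snd ?W \<in> A"
    using centralizer_diff_mem by (auto simp: cext_def)
  then have W: "?W \<in> T \<times> T"
    using A_subset_T by (auto simp: mem_Times_iff)
  obtain x where x: "x \<in> T" "\<beta> (x, 0) \<noteq> 0"
    using root_nonzero_at[OF \<beta>] .
  let ?H = "(x, 0)"
  have H: "?H \<in> T \<times> T" using x by simp
  have "cbr br ?H ?W = cscale (\<beta> ?H) (X \<beta>) - cscale (\<beta> ?H) (cext \<sigma> (X \<beta>))"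
    using root_spaceD[OF X_root_space[OF \<beta>] H]
      root_spaceD[OF cext_root_space[OF X_root_space[OF \<beta>]] H]
    by (simp only: cbr_simps twist)
  also have "\<dots> = cscale (\<beta> ?H) ?W"
    by (simp add: cscale_def prod_eq_iff algebra_simps)
  \<comment> \<open>\<open>?W\<close> is a weight vector for \<beta> and also lies in the abelian
    \<open>T \<times> T\<close>, where the bracket with \<open>?H\<close> vanishes.\<close>
  finally have "cscale (\<beta> ?H) ?W = 0"
    by (simp only: cbr_T_abelian[OF H W])
  then have "?W = 0"
    using x(2) by (simp only: cscale_eq_0_iff) simp
  then show "cext \<sigma> (X \<beta>) = X \<beta>"
    by simp
qed

lemma sign_fixed_root:
  assumes \<beta>: "\<beta> \<in> roots br T" and fixed: "cext \<sigma> (sharp br T \<beta>) = sharp br T \<beta>"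
    and s: "cext \<sigma> (X \<beta>) = cscale s (X (twist \<sigma> \<beta>))"
  shows "s = 1"
proof (rule cscale_left_cancel)
  show "cscale s (X \<beta>) = cscale 1 (X \<beta>)"
    using s cext_X_fixed[OF \<beta> fixed] by simp
qed (rule X_nonzero[OF \<beta>])

lemma sign_sum:
  assumes \<alpha>: "\<alpha> \<in> roots br T" and \<beta>: "\<beta> \<in> roots br T" and \<gamma>: "\<alpha> + \<beta> \<in> roots br T"
    and sg: "\<And>\<alpha>. \<alpha> \<in> roots br T \<Longrightarrow> cext \<sigma> (X \<alpha>) = cscale (sg \<alpha>) (X (twist \<sigma> \<alpha>))"
  shows "sg (\<alpha> + \<beta>) =
    complex_of_real (c (twist \<sigma> \<alpha>) (twist \<sigma> \<beta>) / c \<alpha> \<beta>) * sg \<alpha> * sg \<beta>"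
proof -
  have \<gamma>': "twist \<sigma> \<alpha> + twist \<sigma> \<beta> \<in> roots br T"
    using twist_root[OF \<gamma>] by (simp add: twist_add)
  have "cext \<sigma> (cbr br (X \<alpha>) (X \<beta>)) =
      cscale (complex_of_real (c \<alpha> \<beta>) * sg (\<alpha> + \<beta>)) (X (twist \<sigma> (\<alpha> + \<beta>)))"
    by (simp add: X_bracket[OF \<alpha> \<beta> \<gamma>] scaleR_eq_cscale cext_cscale sg[OF \<gamma>] cscale_cscale)
  moreover have "cext \<sigma> (cbr br (X \<alpha>) (X \<beta>)) =
      cscale (sg \<alpha> * sg \<beta> * complex_of_real (c (twist \<sigma> \<alpha>) (twist \<sigma> \<beta>)))
        (X (twist \<sigma> (\<alpha> + \<beta>)))"
    by (simp add: cext_cbr sg[OF \<alpha>] sg[OF \<beta>] cbr_simps cscale_cscale twist_add mult_ac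
        X_bracket[OF twist_root[OF \<alpha>] twist_root[OF \<beta>] \<gamma>'] scaleR_eq_cscale)
  ultimately have "complex_of_real (c \<alpha> \<beta>) * sg (\<alpha> + \<beta>) =
      sg \<alpha> * sg \<beta> * complex_of_real (c (twist \<sigma> \<alpha>) (twist \<sigma> \<beta>))"
    using X_nonzero[OF twist_root[OF \<gamma>]] by (metis cscale_left_cancel)
  then show ?thesis
    using structure_constant_nonzero[OF \<alpha> \<beta> \<gamma>] by (simp add: field_simps)
qed

end

section \<open>Levels and the algorithm\<close>

context
  fixes br :: "'a::euclidean_space \<Rightarrow> 'a \<Rightarrow> 'a" and T :: "'a set" and \<Psi> :: "'a functional set"
  assumes simple: "simple_system br T \<Psi>"
begin

section \<open>Coefficients and levels of roots\<close>

lemma simple_finite: "finite \<Psi>"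
  and simple_roots: "\<Psi> \<subseteq> roots br T"
  using simple by (auto simp: simple_system_def)

text \<open>Complex linear independence of the simple roots is applied to the differences of the
  integer coefficients.\<close>

lemma combination_unique:
  assumes "combination \<Psi> k = combination \<Psi> k'" "\<gamma> \<in> \<Psi>"
  shows "k \<gamma> = k' \<gamma>"
proof -
  have "(\<Sum>\<gamma>\<in>\<Psi>. of_int (k \<gamma> - k' \<gamma>) * \<gamma> H) = combination \<Psi> k H - combination \<Psi> k' H" for H
    by (simp add: combination_def left_diff_distrib sum_subtractf)
  then have "\<forall>H. (\<Sum>\<gamma>\<in>\<Psi>. (of_int (k \<gamma> - k' \<gamma>) :: complex) * \<gamma> H) = 0"
    by (simp add: assms(1))
  then have "(of_int (k \<gamma> - k' \<gamma>) :: complex) = 0"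
    using simple assms(2) unfolding simple_system_def
    by (elim conjE allE[of _ "\<lambda>\<gamma>. of_int (k \<gamma> - k' \<gamma>)"]) blast
  then show ?thesis
    by (simp only: of_int_eq_0_iff right_minus_eq)
qed

text \<open>Uniqueness of the coefficients makes the description in \<open>level\<close> well
  defined.\<close>

lemma level_combination: "level \<Psi> (combination \<Psi> k) = (\<Sum>\<gamma>\<in>\<Psi>. k \<gamma>)"
  unfolding level_def
proof (rule the_equality)
  show "\<exists>k'. combination \<Psi> k = combination \<Psi> k' \<and> (\<Sum>\<gamma>\<in>\<Psi>. k \<gamma>) = (\<Sum>\<gamma>\<in>\<Psi>. k' \<gamma>)"
    by blast
  show "l = (\<Sum>\<gamma>\<in>\<Psi>. k \<gamma>)"
    if "\<exists>k'. combination \<Psi> k = combination \<Psi> k' \<and> l = (\<Sum>\<gamma>\<in>\<Psi>. k' \<gamma>)" for l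
    using that combination_unique[of k] by (metis (no_types, lifting) sum.cong)
qed

lemma positive_rootE:
  assumes "\<alpha> \<in> positive_roots br T \<Psi>"
  obtains k where "\<alpha> = combination \<Psi> k" "\<And>\<gamma>. \<gamma> \<in> \<Psi> \<Longrightarrow> k \<gamma> \<ge> 0"
  using assms unfolding positive_roots_def by blast

lemma positive_roots_subset: "positive_roots br T \<Psi> \<subseteq> roots br T"
  by (auto simp: positive_roots_def)

lemma combination_single:
  assumes "\<gamma> \<in> \<Psi>" "\<And>\<delta>. \<delta> \<in> \<Psi> \<Longrightarrow> k \<delta> = (if \<delta> = \<gamma> then 1 else 0)"
  shows "combination \<Psi> k = \<gamma>"
proof
  fix H
  have "combination \<Psi> k H = (\<Sum>\<delta>\<in>\<Psi>. if \<delta> = \<gamma> then \<delta> H else 0)"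
    unfolding combination_def by (intro sum.cong) (auto simp: assms(2))
  then show "combination \<Psi> k H = \<gamma> H"
    using assms(1) simple_finite by simp
qed

lemma level_simple:
  assumes "\<gamma> \<in> \<Psi>"
  shows "level \<Psi> \<gamma> = 1"
proof -
  let ?k = "\<lambda>\<delta>. if \<delta> = \<gamma> then 1 else 0 :: int"
  have "level \<Psi> (combination \<Psi> ?k) = 1"
    using assms simple_finite by (simp add: level_combination)
  then show ?thesis
    using combination_single[OF assms, of ?k] by simp
qed

text \<open>Nonnegative coefficients whose sum is not positive all vanish, but a root is not the
  zero functional.\<close>

lemma level_positive_root:
  assumes "\<alpha> \<in> positive_roots br T \<Psi>"
  shows "level \<Psi> \<alpha> \<ge> 1"
proof (rule ccontr)
  assume *: "\<not> level \<Psi> \<alpha> \<ge> 1"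
  obtain k where k: "\<alpha> = combination \<Psi> k" "\<And>\<gamma>. \<gamma> \<in> \<Psi> \<Longrightarrow> k \<gamma> \<ge> 0"
    using positive_rootE[OF assms] by blast
  have "(\<Sum>\<gamma>\<in>\<Psi>. k \<gamma>) = 0"
    using * sum_nonneg[of \<Psi> k] k(2) by (simp add: k(1) level_combination)
  then have "\<forall>\<gamma>\<in>\<Psi>. k \<gamma> = 0"
    using sum_nonneg_eq_0_iff[OF simple_finite] k(2) by blast
  then have "\<alpha> = 0"
    by (simp add: k(1) combination_def fun_eq_iff)
  then show False
    using assms by (simp add: positive_roots_def roots_def)
qed

lemma level_add:
  assumes "\<alpha> \<in> positive_roots br T \<Psi>" "\<beta> \<in> positive_roots br T \<Psi>"
  shows "level \<Psi> (\<alpha> + \<beta>) = level \<Psi> \<alpha> + level \<Psi> \<beta>"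
proof -
  obtain k k' where "\<alpha> = combination \<Psi> k" "\<beta> = combination \<Psi> k'"
    using assms by (auto simp: positive_roots_def)
  moreover have "combination \<Psi> k + combination \<Psi> k' = combination \<Psi> (\<lambda>\<gamma>. k \<gamma> + k' \<gamma>)"
    by (simp add: combination_def fun_eq_iff distrib_right sum.distrib)
  ultimately show ?thesis
    by (simp add: level_combination sum.distrib)
qed

text \<open>Nonnegative integer coefficients of sum 1 consist of a single 1, which describes a
  simple root.\<close>

lemma level_nonsimple_root:
  assumes "\<alpha> \<in> positive_roots br T \<Psi>" "\<alpha> \<notin> \<Psi>"
  shows "level \<Psi> \<alpha> \<ge> 2"
proof (rule ccontr)
  assume *: "\<not> level \<Psi> \<alpha> \<ge> 2"
  obtain k where k: "\<alpha> = combination \<Psi> k" "\<And>\<gamma>. \<gamma> \<in> \<Psi> \<Longrightarrow> k \<gamma> \<ge> 0"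
    using positive_rootE[OF assms(1)] by blast
  have one: "(\<Sum>\<gamma>\<in>\<Psi>. k \<gamma>) = 1"
    using * level_positive_root[OF assms(1)] by (simp add: k(1) level_combination)
  then obtain \<gamma> where \<gamma>: "\<gamma> \<in> \<Psi>" "k \<gamma> \<noteq> 0"
    by (metis sum.neutral zero_neq_one)
  have "1 = k \<gamma> + (\<Sum>\<delta>\<in>\<Psi> - {\<gamma>}. k \<delta>)"
    using one sum.remove[OF simple_finite \<gamma>(1), of k] by simp
  moreover have "k \<gamma> \<ge> 1"
    using \<gamma> k(2)[OF \<gamma>(1)] by simp
  moreover have "(\<Sum>\<delta>\<in>\<Psi> - {\<gamma>}. k \<delta>) \<ge> 0"
    by (intro sum_nonneg) (use k(2) in auto)
  ultimately have "k \<gamma> = 1" "(\<Sum>\<delta>\<in>\<Psi> - {\<gamma>}. k \<delta>) = 0"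
    by linarith+
  moreover from this(2) have "\<forall>\<delta>\<in>\<Psi> - {\<gamma>}. k \<delta> = 0"
    using sum_nonneg_eq_0_iff[of "\<Psi> - {\<gamma>}" k] simple_finite k(2) by auto
  ultimately have "\<alpha> = \<gamma>"
    unfolding k(1) by (intro combination_single[OF \<gamma>(1)]) auto
  with \<gamma>(1) assms(2) show False by simp
qed

text \<open>A positive level excludes coefficients that are all nonpositive, and simple roots have
  level 1. The loop thus meets only positive nonsimple roots.\<close>

lemma root_level_ge_2:
  assumes "\<alpha> \<in> roots br T" "level \<Psi> \<alpha> \<ge> 2"
  shows "\<alpha> \<in> positive_roots br T \<Psi> - \<Psi>"
proof -
  obtain k where k: "\<alpha> = combination \<Psi> k" "(\<forall>\<gamma>\<in>\<Psi>. k \<gamma> \<ge> 0) \<or> (\<forall>\<gamma>\<in>\<Psi>. k \<gamma> \<le> 0)"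
    using simple assms(1) unfolding simple_system_def by blast
  have "\<not> (\<forall>\<gamma>\<in>\<Psi>. k \<gamma> \<le> 0)"
    using assms(2) sum_nonpos[of \<Psi> k] by (auto simp: k(1) level_combination)
  then have "\<alpha> \<in> positive_roots br T \<Psi>"
    using k assms(1) by (auto simp: positive_roots_def)
  moreover have "\<alpha> \<notin> \<Psi>"
    using level_simple assms(2) by fastforce
  ultimately show ?thesis by simp
qed

end

section \<open>Correctness of the loop\<close>

text \<open>The set \<open>D\<close> is the loop invariant: the functionals whose entries are
  already correct. It gains the head of the list in each step, so it suffices that both summands
  occur in \<open>D\<close> or earlier in the list.\<close>

lemma alg_loop_correct:
  assumes "\<And>\<gamma>. \<gamma> \<in> D \<Longrightarrow> st \<gamma> = Some (sg \<gamma>)"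
    and "\<And>xs \<alpha> ys. as = xs @ \<alpha> # ys \<Longrightarrow> Z \<alpha> \<in> D \<union> set xs \<and> E \<alpha> \<in> D \<union> set xs"
    and "\<And>\<alpha>. \<alpha> \<in> set as \<Longrightarrow> Z \<alpha> + E \<alpha> \<in> \<Delta> \<and> twist \<sigma> (Z \<alpha>) \<in> \<Delta> \<and> twist \<sigma> (E \<alpha>) \<in> \<Delta> \<and>
      twist \<sigma> (Z \<alpha>) + twist \<sigma> (E \<alpha>) \<in> \<Delta> \<and> c (Z \<alpha>) (E \<alpha>) \<noteq> 0 \<and>
      sg \<alpha> = complex_of_real (c (twist \<sigma> (Z \<alpha>)) (twist \<sigma> (E \<alpha>)) / c (Z \<alpha>) (E \<alpha>)) *
        sg (Z \<alpha>) * sg (E \<alpha>)"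
  shows "\<exists>st'. alg_loop \<Delta> \<sigma> c Z E as st = Some st' \<and> (\<forall>\<gamma>\<in>D \<union> set as. st' \<gamma> = Some (sg \<gamma>))"
  using assms
proof (induction as arbitrary: D st)
  case Nil
  then show ?case by simp
next
  case (Cons \<alpha> as)
  have "Z \<alpha> \<in> D" "E \<alpha> \<in> D"
    using Cons.prems(2)[of "[]" \<alpha> as] by auto
  note st_summands = this[THEN Cons.prems(1)]
  have cond: "Z \<alpha> + E \<alpha> \<in> \<Delta>" "twist \<sigma> (Z \<alpha>) \<in> \<Delta>" "twist \<sigma> (E \<alpha>) \<in> \<Delta>"
      "twist \<sigma> (Z \<alpha>) + twist \<sigma> (E \<alpha>) \<in> \<Delta>" "c (Z \<alpha>) (E \<alpha>) \<noteq> 0"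
    and sg: "sg \<alpha> = complex_of_real (c (twist \<sigma> (Z \<alpha>)) (twist \<sigma> (E \<alpha>)) / c (Z \<alpha>) (E \<alpha>)) *
      sg (Z \<alpha>) * sg (E \<alpha>)"
    using Cons.prems(3)[OF list.set_intros(1)] by blast+
  have step: "alg_step \<Delta> \<sigma> c (Z \<alpha>) (E \<alpha>) \<alpha> st = Some (st(\<alpha> \<mapsto> sg \<alpha>))"
    unfolding alg_step_def st_summands prod.case option.case by (simp only: cond sg if_True simp_thms)
  have "\<exists>st'. alg_loop \<Delta> \<sigma> c Z E as (st(\<alpha> \<mapsto> sg \<alpha>)) = Some st' \<and>
      (\<forall>\<gamma>\<in>insert \<alpha> D \<union> set as. st' \<gamma> = Some (sg \<gamma>))"
  proof (rule Cons.IH)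
    show "Z \<gamma> \<in> insert \<alpha> D \<union> set xs \<and> E \<gamma> \<in> insert \<alpha> D \<union> set xs"
      if "as = xs @ \<gamma> # ys" for xs \<gamma> ys
      using Cons.prems(2)[of "\<alpha> # xs" \<gamma> ys] that by auto
  qed (use Cons.prems(1,3) in auto)
  then show ?case
    by (simp add: step)
qed

text \<open>Within one block all levels agree, so any order chosen there is admissible; across
  blocks the levels follow \<open>ls\<close>.\<close>

lemma sorted_wrt_concat_levels:
  assumes "sorted ls" "\<And>l \<alpha>. l \<in> set ls \<Longrightarrow> \<alpha> \<in> set (ord l) \<Longrightarrow> f \<alpha> = l"
  shows "sorted_wrt (\<lambda>\<alpha> \<beta>. f \<alpha> \<le> f \<beta>) (concat (map ord ls))"
  using assms
proof (induction ls)
  case (Cons l ls)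
  have "sorted_wrt (\<lambda>\<alpha> \<beta>. f \<alpha> \<le> f \<beta>) (ord l)"
    using Cons.prems(2)[of l] by (auto simp: sorted_wrt_iff_nth_less)
  moreover have "sorted_wrt (\<lambda>\<alpha> \<beta>. f \<alpha> \<le> f \<beta>) (concat (map ord ls))"
    using Cons by simp
  moreover have "f \<alpha> \<le> f \<beta>" if "\<alpha> \<in> set (ord l)" "\<beta> \<in> set (concat (map ord ls))" for \<alpha> \<beta>
    using that Cons.prems(1) Cons.prems(2)[of l \<alpha>] Cons.prems(2)[of _ \<beta>] by fastforce
  ultimately show ?case
    by (simp add: sorted_wrt_append)
qed simp

section \<open>Assembly of the correctness statement\<close>

text \<open>The first conjunct keeps the second from being vacuous. A result \<open>Some st\<close>
  records that no value was missing and no denominator was zero, whatever choices the schedule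
  makes.\<close>

theorem mainTheorem9:
  fixes br :: "'a::euclidean_space \<Rightarrow> 'a \<Rightarrow> 'a"
    and \<sigma> :: "'a \<Rightarrow> 'a"
    and A T :: "'a set"
    and \<Psi> :: "'a functional set"
    and r s :: nat
    and wh bl :: "nat \<Rightarrow> 'a functional"
    and \<pi> :: "nat \<Rightarrow> nat"
    and X :: "'a functional \<Rightarrow> 'a \<times> 'a"
    and c :: "'a functional \<Rightarrow> 'a functional \<Rightarrow> real"
    and dz de :: "'a functional \<Rightarrow> 'a functional"
    and \<beta> :: "'a functional"
    and sg :: "'a functional \<Rightarrow> complex"
  assumes symmetric: "irreducible_compact_symmetric br \<sigma>"
    and flat: "maximal_flat_subspace br \<sigma> A"
    and cartan: "cartan_subalgebra br T" "A \<subseteq> T"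
    and satake: "satake_system br \<sigma> T \<Psi> r s wh bl \<pi>"
    and chevalley: "chevalley_basis br T \<Psi> X c dz de"
    and numbering:
      "\<And>n q. 2 * q + 1 < n \<Longrightarrow> type_AIII br \<sigma> n q \<Longrightarrow> numbering_AIII br T \<Psi> r s wh bl \<pi> q \<beta>"
      "\<And>n. odd n \<Longrightarrow> type_DIII br \<sigma> n \<Longrightarrow> numbering_DIII br T \<Psi> s wh bl \<pi> n \<beta>"
      "type_EIII br \<sigma> T \<Psi> \<Longrightarrow> numbering_EIII br T \<Psi> r s wh bl \<pi> \<beta>"
    and sg: "\<And>\<alpha>. \<alpha> \<in> roots br T \<Longrightarrow> cext \<sigma> (X \<alpha>) = cscale (sg \<alpha>) (X (twist \<sigma> \<alpha>))"
    and normalization_special: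
      "special_type br \<sigma> T \<Psi> \<Longrightarrow>
         sg (wh (\<pi> 1)) = complex_of_real (c \<beta> (wh 1) / c (wh (\<pi> 1)) \<beta>) \<and>
         (\<forall>k\<in>{1..r}. k \<noteq> \<pi> 1 \<longrightarrow> sg (wh k) = 1)"
    and normalization_other:
      "\<not> special_type br \<sigma> T \<Psi> \<Longrightarrow> \<forall>k\<in>{1..r}. sg (wh k) = 1"
  shows "(\<exists>ord Z E. alg_schedule br T \<Psi> ord Z E) \<and>
    (\<forall>ord Z E. alg_schedule br T \<Psi> ord Z E \<longrightarrow>
       (\<exists>st. alg_run br \<sigma> T \<Psi> c (wh 1) (wh (\<pi> 1)) \<beta> ord Z E = Some st \<and>
          (\<forall>\<alpha>\<in>positive_roots br T \<Psi>. st \<alpha> = Some (sg \<alpha>))))"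
proof -
  interpret compact_symmetric_chevalley br T \<Psi> X c dz de \<sigma> A
    using symmetric flat cartan chevalley
    by unfold_locales (auto simp: irreducible_compact_symmetric_def)
  let ?\<Delta> = "roots br T" and ?P = "positive_roots br T \<Psi>" and ?L = "max_level br T \<Psi>"
  let ?init = "alg_init \<Psi> (special_type br \<sigma> T \<Psi>) c (wh 1) (wh (\<pi> 1)) \<beta>"
  have simple: "simple_system br T \<Psi>"
    and inj: "inj_on wh {1..r}" and disjoint: "wh ` {1..r} \<inter> bl ` {1..s} = {}"
    and \<Psi>: "\<Psi> = wh ` {1..r} \<union> bl ` {1..s}" and perm: "\<pi> permutes {1..r}"
    and black: "\<And>k. k \<in> {1..s} \<Longrightarrow> cext \<sigma> (sharp br T (bl k)) = sharp br T (bl k)"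
    using satake unfolding satake_system_def by blast+
  have P_roots: "\<alpha> \<in> ?\<Delta>" if "\<alpha> \<in> ?P" for \<alpha>
    using that positive_roots_subset[OF simple] by blast
  have level_le: "level \<Psi> \<alpha> \<le> ?L" if "\<alpha> \<in> ?\<Delta>" for \<alpha>
    using that finite_roots by (simp add: max_level_def)

  \<comment> \<open>Only for an index in the white range do injectivity of \<open>wh\<close> and
    disjointness from the black roots single out the exceptional simple root.\<close>
  have \<pi>1: "\<pi> 1 \<in> {1..r}" if special: "special_type br \<sigma> T \<Psi>"
  proof -
    have "1 \<in> {1..r}"
      using special unfolding special_type_def
    proof (elim disjE exE conjE)
      fix n q assume "2 * q + 1 < n" "type_AIII br \<sigma> n q"
      then have "r = 2 * q" "q \<ge> 1"
        using numbering(1) by (auto simp: numbering_AIII_def type_AIII_def)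
      then show ?thesis by simp
    next
      fix n assume "odd n" "type_DIII br \<sigma> n"
      \<comment> \<open>A permutation of \<open>{1..r}\<close> fixes all other indices, so the
        distinct ends of the fork force 1 into the range.\<close>
      then have "wh 1 \<noteq> wh (\<pi> 1)"
        using numbering(2) by (auto simp: numbering_DIII_def)
      then show ?thesis
        using permutes_not_in[OF perm, of 1] by auto
    next
      assume "type_EIII br \<sigma> T \<Psi>"
      then show ?thesis
        using numbering(3) by (simp add: numbering_EIII_def)
    qed
    then show ?thesis
      using permutes_in_image[OF perm] by simp
  qed

  have sg_black: "sg (bl k) = 1" if "k \<in> {1..s}" for k
  proof -
    have "bl k \<in> ?\<Delta>"
      using that \<Psi> simple_roots[OF simple] by blast
    then show ?thesis
      using sign_fixed_root black[OF that] sg by blast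
  qed

  have init: "?init \<gamma> = Some (sg \<gamma>)" if \<gamma>: "\<gamma> \<in> \<Psi>" for \<gamma>
  proof (cases "special_type br \<sigma> T \<Psi>")
    case True
    \<comment> \<open>The start state tests equality of functionals, so the exceptional root must be
      separated from the black and the remaining white roots.\<close>
    have "wh (\<pi> 1) \<noteq> bl k" if "k \<in> {1..s}" for k
      using disjoint \<pi>1[OF True] that by blast
    moreover have "wh k = wh (\<pi> 1) \<longleftrightarrow> k = \<pi> 1" if "k \<in> {1..r}" for k
      using inj_on_eq_iff[OF inj that \<pi>1[OF True]] .
    ultimately show ?thesis
      using \<gamma> \<Psi> True normalization_special[OF True] sg_black
      by (fastforce simp: alg_init_def)
  next
    case False
    then show ?thesis
      using \<gamma> \<Psi> normalization_other sg_black by (auto simp: alg_init_def)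
  qed

  have "\<exists>xs. distinct xs \<and> set xs = {\<alpha> \<in> ?\<Delta>. level \<Psi> \<alpha> = l}" for l
    using finite_distinct_list[of "{\<alpha> \<in> ?\<Delta>. level \<Psi> \<alpha> = l}"] finite_roots by auto
  then obtain ord where ord: "\<And>l. distinct (ord l) \<and> set (ord l) = {\<alpha> \<in> ?\<Delta>. level \<Psi> \<alpha> = l}"
    by metis
  \<comment> \<open>The decompositions that come with the Chevalley basis serve as the choice of
    summands.\<close>
  have "alg_schedule br T \<Psi> ord dz de"
    unfolding alg_schedule_def
  proof (intro ballI conjI)
    fix l \<alpha> assume l: "l \<in> {2..?L}" and "\<alpha> \<in> set (ord l)"
    then have \<alpha>: "\<alpha> \<in> ?P - \<Psi>"
      using ord[of l] by (intro root_level_ge_2[OF simple]) auto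
    show "dz \<alpha> \<in> ?P" "de \<alpha> \<in> ?P" "\<alpha> = dz \<alpha> + de \<alpha>"
      by (rule positive_root_decomp[OF \<alpha>])+
  qed (simp_all only: ord)
  moreover have "\<exists>st. alg_run br \<sigma> T \<Psi> c (wh 1) (wh (\<pi> 1)) \<beta> ord Z E = Some st \<and>
      (\<forall>\<alpha>\<in>?P. st \<alpha> = Some (sg \<alpha>))" if schedule: "alg_schedule br T \<Psi> ord Z E" for ord Z E
  proof -
    let ?as = "concat (map ord [2..?L])"
    have set_ord: "set (ord l) = {\<alpha> \<in> ?\<Delta>. level \<Psi> \<alpha> = l}"
      and decomp: "\<And>\<alpha>. \<alpha> \<in> set (ord l) \<Longrightarrow> Z \<alpha> \<in> ?P \<and> E \<alpha> \<in> ?P \<and> \<alpha> = Z \<alpha> + E \<alpha>"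
      if "l \<in> {2..?L}" for l
      using schedule that unfolding alg_schedule_def by blast+
    have set_as: "set ?as = {\<alpha> \<in> ?\<Delta>. level \<Psi> \<alpha> \<ge> 2}"
      using set_ord level_le by fastforce
    have as: "Z \<alpha> \<in> ?P" "E \<alpha> \<in> ?P" "\<alpha> = Z \<alpha> + E \<alpha>" "\<alpha> \<in> ?\<Delta>" if "\<alpha> \<in> set ?as" for \<alpha>
      using that decomp set_ord by auto
    have cover: "\<alpha> \<in> \<Psi> \<union> set ?as" if "\<alpha> \<in> ?P" for \<alpha>
      unfolding set_as using that level_nonsimple_root[OF simple that] P_roots[OF that] by auto
    have sorted: "sorted_wrt (\<lambda>\<alpha> \<beta>. level \<Psi> \<alpha> \<le> level \<Psi> \<beta>) ?as"
      by (rule sorted_wrt_concat_levels) (auto simp: set_ord)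
    have "\<exists>st. alg_loop ?\<Delta> \<sigma> c Z E ?as ?init = Some st \<and>
        (\<forall>\<gamma>\<in>\<Psi> \<union> set ?as. st \<gamma> = Some (sg \<gamma>))"
    proof (rule alg_loop_correct)
      show "?init \<gamma> = Some (sg \<gamma>)" if "\<gamma> \<in> \<Psi>" for \<gamma>
        using that by (rule init)
    next
      fix xs \<alpha> ys assume split: "?as = xs @ \<alpha> # ys"
      then have \<alpha>: "\<alpha> \<in> set ?as" by simp
      have lower: "\<gamma> \<in> \<Psi> \<union> set xs" if "\<gamma> \<in> ?P" "level \<Psi> \<gamma> < level \<Psi> \<alpha>" for \<gamma>
      proof -
        \<comment> \<open>From \<alpha> onwards the list contains only levels at least that of
          \<alpha>.\<close>
        have "\<gamma> \<notin> set (\<alpha> # ys)"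
          using sorted that(2) unfolding split by (auto simp: sorted_wrt_append)
        then show ?thesis
          using cover[OF that(1)] unfolding split by auto
      qed
      \<comment> \<open>Both summands have level at least 1, so each lies strictly below \<alpha>
        and was treated before it.\<close>
      have "level \<Psi> \<alpha> = level \<Psi> (Z \<alpha>) + level \<Psi> (E \<alpha>)"
        using as(3)[OF \<alpha>] level_add[OF simple as(1,2)[OF \<alpha>]] by simp
      then show "Z \<alpha> \<in> \<Psi> \<union> set xs \<and> E \<alpha> \<in> \<Psi> \<union> set xs"
        using lower as(1,2)[OF \<alpha>] level_positive_root[OF simple, of "Z \<alpha>"]
          level_positive_root[OF simple, of "E \<alpha>"] by auto
    next
      fix \<alpha> assume \<alpha>: "\<alpha> \<in> set ?as"
      have Z: "Z \<alpha> \<in> ?\<Delta>" and E: "E \<alpha> \<in> ?\<Delta>" and sum: "Z \<alpha> + E \<alpha> \<in> ?\<Delta>"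
        using as[OF \<alpha>] P_roots by auto
      show "Z \<alpha> + E \<alpha> \<in> ?\<Delta> \<and> twist \<sigma> (Z \<alpha>) \<in> ?\<Delta> \<and> twist \<sigma> (E \<alpha>) \<in> ?\<Delta> \<and>
          twist \<sigma> (Z \<alpha>) + twist \<sigma> (E \<alpha>) \<in> ?\<Delta> \<and> c (Z \<alpha>) (E \<alpha>) \<noteq> 0 \<and>
          sg \<alpha> = complex_of_real (c (twist \<sigma> (Z \<alpha>)) (twist \<sigma> (E \<alpha>)) / c (Z \<alpha>) (E \<alpha>)) *
            sg (Z \<alpha>) * sg (E \<alpha>)"
        using sign_sum[OF Z E sum sg] as(3)[OF \<alpha>] structure_constant_nonzero[OF Z E sum]
          sum twist_root[OF Z] twist_root[OF E] twist_root[OF sum, unfolded twist_add]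
        by simp
    qed
    then show ?thesis
      using cover by (auto simp: alg_run_def)
  qed
  ultimately show ?thesis by blast
qed

end
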